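(* Let $\mathbb{F}$ be a field with algebraic closure $\overline{\mathbb{F}}$ such that $[\overline{\mathbb{F}}:\mathbb{F}]$ is finite of degree $m \neq 1$. Suppose furthermore that $\vert \mathrm{Aut}(\mathbb{F})\vert < \vert \mathbb{F}\vert$. Then, for every odd $n \in \mathbb{N} \setminus \{0,1,2\}$, $\mathbf{PG}(n-1,\mathbb{F})$ does not admit a Singer group.
   Context: $\vert\cdot\vert$ denotes cardinality and $\mathrm{Aut}(\mathbb{F})$ is the group of field automorphisms of $\mathbb{F}$. $\mathbf{PG}(n-1,\mathbb{F})$ is the projective space of the vector space $\mathbb{F}^n$; its points are the $1$-dimensional subspaces, and its automorphism group is $\mathbf{P\Gamma L}_n(\mathbb{F})$ (semilinear bijections modulo scalars). A Singer group is a subgroup of this automorphism group acting sharply transitively on the points (for any two points $x,y$ there is exactly one group element mapping $x$ to $y$). *)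

theory Defs
  imports
    "HOL-Analysis.Cartesian_Space"
    "HOL-Algebra.Algebraic_Closure_Type"
    "HOL-Algebra.Bij"
    "HOL-Algebra.Coset"
    "HOL-Library.Equipollence"
begin

definition field_auts :: "('a::field \<Rightarrow> 'a) set" where
  "field_auts = ring_iso ring_of_type_algebra ring_of_type_algebra"

lemma field_auts_iff:
  "\<sigma> \<in> field_auts \<longleftrightarrow>
     bij \<sigma> \<and> (\<forall>x y. \<sigma> (x + y) = \<sigma> x + \<sigma> y) \<and> (\<forall>x y. \<sigma> (x * y) = \<sigma> x * \<sigma> y) \<and> \<sigma> 1 = 1"
  by (auto simp: field_auts_def ring_iso_def ring_hom_def ring_of_type_algebra_def)


section \<open>The degree of the algebraic closure\<close>

definition ac_scale :: "'a::field \<Rightarrow> 'a alg_closure \<Rightarrow> 'a alg_closure" where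
  "ac_scale c x = to_ac c * x"

global_interpretation ac: vector_space ac_scale
  by unfold_locales (simp_all add: ac_scale_def algebra_simps)

text \<open>The degree is given as a relation because \<^const>\<open>ac.dim\<close> is \<^term>\<open>0\<close> in infinite dimension;
  \<^term>\<open>alg_closure_degree TYPE('a::field) m\<close> includes that the degree is finite.\<close>

definition alg_closure_degree :: "'a::field itself \<Rightarrow> nat \<Rightarrow> bool" where
  "alg_closure_degree _ m \<longleftrightarrow>
     (\<exists>B :: 'a alg_closure set. finite B \<and> ac.independent B \<and> ac.span B = UNIV \<and> card B = m)"


section \<open>Semilinear groups\<close>

definition semilinear :: "('a::field ^ 'n \<Rightarrow> 'a ^ 'n) \<Rightarrow> bool" where
  "semilinear f \<longleftrightarrow> (\<forall>v w. f (v + w) = f v + f w) \<and>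
     (\<exists>\<sigma>\<in>field_auts. \<forall>c v. f (c *s v) = \<sigma> c *s f v)"

definition GammaL :: "('a::field ^ 'n \<Rightarrow> 'a ^ 'n) monoid" where
  "GammaL = BijGroup UNIV \<lparr>carrier := {f. bij f \<and> semilinear f}\<rparr>"

definition scalars :: "('a::field ^ 'n \<Rightarrow> 'a ^ 'n) set" where
  "scalars = {\<lambda>v. c *s v | c. c \<noteq> 0}"

definition PGammaL :: "('a::field ^ 'n \<Rightarrow> 'a ^ 'n) set monoid" where
  "PGammaL = GammaL Mod scalars"

lemma GammaL_mult:
  "f \<otimes>\<^bsub>BijGroup UNIV\<^esub> g = f \<circ> g" if "bij f" "bij g"
  using that by (auto simp: BijGroup_def Bij_def compose_def)

lemma subgroup_GammaL:
  "subgroup {f :: 'a::field ^ 'n \<Rightarrow> 'a ^ 'n. bij f \<and> semilinear f} (BijGroup UNIV)"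
proof -
  interpret B: group "BijGroup (UNIV :: ('a ^ 'n) set)" by (rule group_BijGroup)
  have carr: "carrier (BijGroup (UNIV :: ('a ^ 'n) set)) = {f. bij f}"
    by (auto simp: BijGroup_def Bij_def)
  have one: "\<one>\<^bsub>BijGroup (UNIV :: ('a ^ 'n) set)\<^esub> = id"
    by (auto simp: BijGroup_def)
  have inv: "inv\<^bsub>BijGroup UNIV\<^esub> f = inv_into UNIV f" if "bij f" for f :: "'a ^ 'n \<Rightarrow> 'a ^ 'n"
  proof (rule B.inv_equality)
    show "inv_into UNIV f \<otimes>\<^bsub>BijGroup UNIV\<^esub> f = \<one>\<^bsub>BijGroup UNIV\<^esub>"
      using that by (simp add: GammaL_mult bij_imp_bij_inv one bij_is_inj)
  qed (use that in \<open>auto simp: carr bij_imp_bij_inv\<close>)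
  show ?thesis
  proof (rule B.subgroupI)
    have "id \<in> {f :: 'a ^ 'n \<Rightarrow> 'a ^ 'n. bij f \<and> semilinear f}"
      unfolding semilinear_def by (auto intro!: bexI[of _ id] simp: field_auts_iff)
    then show "{f :: 'a ^ 'n \<Rightarrow> 'a ^ 'n. bij f \<and> semilinear f} \<noteq> {}" by blast
  next
    fix f :: "'a ^ 'n \<Rightarrow> 'a ^ 'n"
    assume "f \<in> {f. bij f \<and> semilinear f}"
    then obtain \<sigma> where f: "bij f" "\<And>v w. f (v + w) = f v + f w" "\<sigma> \<in> field_auts"
      "\<And>c v. f (c *s v) = \<sigma> c *s f v" by (auto simp: semilinear_def)
    let ?g = "inv_into UNIV f" and ?\<tau> = "inv_into UNIV \<sigma>"
    have \<sigma>: "bij \<sigma>" "\<And>x y. \<sigma> (x + y) = \<sigma> x + \<sigma> y" "\<And>x y. \<sigma> (x * y) = \<sigma> x * \<sigma> y" "\<sigma> 1 = 1"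
      using f(3) by (auto simp: field_auts_iff)
    have fg: "f (?g v) = v" for v using f(1) by (simp add: bij_is_surj surj_f_inv_f)
    have st: "\<sigma> (?\<tau> x) = x" for x using \<sigma>(1) by (simp add: bij_is_surj surj_f_inv_f)
    have fi: "f v = f w \<Longrightarrow> v = w" for v w using f(1) by (simp add: bij_is_inj inj_eq)
    have si: "\<sigma> v = \<sigma> w \<Longrightarrow> v = w" for v w using \<sigma>(1) by (simp add: bij_is_inj inj_eq)
    have "?\<tau> (x + y) = ?\<tau> x + ?\<tau> y" "?\<tau> (x * y) = ?\<tau> x * ?\<tau> y" "?\<tau> 1 = 1" for x y
      by (rule si, simp only: st \<sigma>)+
    then have "?\<tau> \<in> field_auts"
      unfolding field_auts_iff using bij_imp_bij_inv[OF \<sigma>(1)] by blast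
    moreover have "?g (v + w) = ?g v + ?g w" for v w by (rule fi) (simp only: fg f(2))
    moreover have "?g (c *s v) = ?\<tau> c *s ?g v" for c v by (rule fi) (simp only: fg f(4) st)
    ultimately show "inv\<^bsub>BijGroup UNIV\<^esub> f \<in> {f. bij f \<and> semilinear f}"
      using f(1)
      unfolding mem_Collect_eq inv[OF f(1)] semilinear_def by (blast intro: bij_imp_bij_inv)
  next
    fix f g :: "'a ^ 'n \<Rightarrow> 'a ^ 'n"
    assume f: "f \<in> {f. bij f \<and> semilinear f}" and g: "g \<in> {f. bij f \<and> semilinear f}"
    from f obtain \<sigma> where \<sigma>: "\<sigma> \<in> field_auts" "\<And>c v. f (c *s v) = \<sigma> c *s f v"
      by (auto simp: semilinear_def)
    from g obtain \<tau> where \<tau>: "\<tau> \<in> field_auts" "\<And>c v. g (c *s v) = \<tau> c *s g v"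
      by (auto simp: semilinear_def)
    have "\<sigma> \<circ> \<tau> \<in> field_auts"
      using \<sigma>(1) \<tau>(1) by (auto simp: field_auts_iff bij_comp)
    then have "semilinear (f \<circ> g)"
      using f g \<sigma> \<tau> by (auto simp: semilinear_def intro!: bexI[of _ "\<sigma> \<circ> \<tau>"])
    with f g show "f \<otimes>\<^bsub>BijGroup UNIV\<^esub> g \<in> {f. bij f \<and> semilinear f}"
      by (simp add: GammaL_mult bij_comp)
  qed (auto simp: carr)
qed

lemma group_GammaL: "group (GammaL :: ('a::field ^ 'n \<Rightarrow> _) monoid)"
  unfolding GammaL_def
  by (rule subgroup.subgroup_is_group[OF subgroup_GammaL group_BijGroup])

lemma scalar_in_GammaL:
  assumes "c \<noteq> (0 :: 'a::field)"
  shows "(\<lambda>v :: 'a ^ 'n. c *s v) \<in> carrier GammaL"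
proof -
  have "bij (\<lambda>v :: 'a ^ 'n. c *s v)"
    by (rule o_bij[of "\<lambda>v. inverse c *s v"])
       (use assms in \<open>auto simp: fun_eq_iff vector_smult_assoc\<close>)
  then show ?thesis
    by (auto simp: GammaL_def semilinear_def vec.scale_right_distrib vector_smult_assoc
        mult.commute field_auts_iff intro!: bexI[of _ id])
qed

lemma GammaL_carrier: "carrier GammaL = {f. bij f \<and> semilinear f}"
  by (simp add: GammaL_def)

lemma GammaL_mult': "f \<otimes>\<^bsub>GammaL\<^esub> g = f \<circ> g" if "f \<in> carrier GammaL" "g \<in> carrier GammaL"
  using that GammaL_mult[of f g] by (simp add: GammaL_def)

lemma normal_scalars: "(scalars :: ('a::field ^ 'n \<Rightarrow> _) set) \<lhd> GammaL"
proof -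
  interpret G: group "GammaL :: ('a ^ 'n \<Rightarrow> _) monoid" by (rule group_GammaL)
  have sub: "(scalars :: ('a ^ 'n \<Rightarrow> _) set) \<subseteq> carrier GammaL"
    by (auto simp: scalars_def scalar_in_GammaL)
  have one: "\<one>\<^bsub>GammaL\<^esub> = (id :: 'a ^ 'n \<Rightarrow> _)"
    by (auto simp: GammaL_def BijGroup_def)
  have mult: "h \<otimes>\<^bsub>GammaL\<^esub> k \<in> scalars" if hk: "h \<in> scalars" "k \<in> scalars"
    for h k :: "'a ^ 'n \<Rightarrow> _"
  proof -
    have "h \<otimes>\<^bsub>GammaL\<^esub> k = h \<circ> k" using hk sub by (intro GammaL_mult') auto
    also from hk obtain c d where "h = (\<lambda>v. c *s v)" "k = (\<lambda>v. d *s v)" "c \<noteq> 0" "d \<noteq> 0"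
      by (auto simp: scalars_def)
    then have "h \<circ> k = (\<lambda>v. (c * d) *s v)" "c * d \<noteq> 0" by (auto simp: vector_smult_assoc)
    then have "h \<circ> k \<in> scalars" unfolding scalars_def by blast
    finally show ?thesis .
  qed
  have inv: "inv\<^bsub>GammaL\<^esub> h \<in> scalars" if h: "h \<in> scalars" for h :: "'a ^ 'n \<Rightarrow> _"
  proof -
    from h obtain c where c: "h = (\<lambda>v. c *s v)" "c \<noteq> 0" by (auto simp: scalars_def)
    have k: "(\<lambda>v. inverse c *s v) \<in> carrier (GammaL :: ('a ^ 'n \<Rightarrow> _) monoid)"
      using c by (intro scalar_in_GammaL) auto
    have "inv\<^bsub>GammaL\<^esub> h = (\<lambda>v. inverse c *s v)"
      by (rule G.inv_equality)
         (use c k h sub in \<open>auto simp: GammaL_mult' one vector_smult_assoc fun_eq_iff\<close>)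
    with c show ?thesis by (auto simp: scalars_def)
  qed
  have "subgroup (scalars :: ('a ^ 'n \<Rightarrow> _) set) GammaL"
  proof (rule G.subgroupI[OF sub])
    show "(scalars :: ('a ^ 'n \<Rightarrow> _) set) \<noteq> {}"
      by (auto simp: scalars_def intro!: exI[of _ 1])
  qed (fact inv, fact mult)
  moreover have "f \<otimes>\<^bsub>GammaL\<^esub> h \<otimes>\<^bsub>GammaL\<^esub> inv\<^bsub>GammaL\<^esub> f \<in> scalars"
    if f: "f \<in> carrier GammaL" and h: "h \<in> scalars" for f h :: "'a ^ 'n \<Rightarrow> _"
  proof -
    from h obtain c where c: "h = (\<lambda>v. c *s v)" "c \<noteq> 0" by (auto simp: scalars_def)
    from f obtain \<sigma> where \<sigma>: "\<sigma> \<in> field_auts" "\<And>c v. f (c *s v) = \<sigma> c *s f v"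
      by (auto simp: GammaL_carrier semilinear_def)
    have "bij \<sigma>" "\<sigma> (0 + 0) = \<sigma> 0 + \<sigma> 0"
      using \<sigma>(1) unfolding field_auts_iff by blast+
    then have "\<sigma> 0 = 0" by (simp only: add_0_right add_cancel_right_right)
    with \<open>bij \<sigma>\<close> have s: "\<sigma> c \<noteq> 0"
      using c(2) injD[OF bij_is_inj, of \<sigma> c 0] by auto
    let ?h = "\<lambda>v :: 'a ^ 'n. \<sigma> c *s v"
    have hc: "?h \<in> carrier GammaL" by (rule scalar_in_GammaL[OF s])
    have "f \<otimes>\<^bsub>GammaL\<^esub> h = ?h \<otimes>\<^bsub>GammaL\<^esub> f"
      using GammaL_mult'[OF f, of h] GammaL_mult'[OF hc f] h sub
      by (auto simp: c(1) \<sigma>(2) fun_eq_iff)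
    then have "f \<otimes>\<^bsub>GammaL\<^esub> h \<otimes>\<^bsub>GammaL\<^esub> inv\<^bsub>GammaL\<^esub> f = ?h"
      using G.inv_solve_right[OF hc G.m_closed[OF hc f] f] by metis
    with s show ?thesis by (auto simp: scalars_def)
  qed
  ultimately show ?thesis
    by (auto simp: G.normal_inv_iff)
qed


section \<open>Projective space and Singer groups\<close>

definition pg_points :: "('a::field ^ 'n) set set" where
  "pg_points = {U. vec.subspace U \<and> vec.dim U = 1}"

text \<open>An element of \<^const>\<open>PGammaL\<close> is a coset; it acts on points through any of its
  representatives (see \<open>pg_act_eq\<close> below for the independence of the choice).\<close>

definition pg_act :: "('a::field ^ 'n \<Rightarrow> 'a ^ 'n) set \<Rightarrow> ('a ^ 'n) set \<Rightarrow> ('a ^ 'n) set" where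
  "pg_act g U = (SOME f. f \<in> g) ` U"

definition singer_group :: "('a::field ^ 'n \<Rightarrow> 'a ^ 'n) set set \<Rightarrow> bool" where
  "singer_group S \<longleftrightarrow> subgroup S PGammaL \<and>
     (\<forall>x\<in>pg_points. \<forall>y\<in>pg_points. \<exists>!g. g \<in> S \<and> pg_act g x = y)"

lemma subspace_scale_image:
  assumes "vec.subspace (U :: ('a::field ^ 'n) set)" "c \<noteq> 0"
  shows "(\<lambda>v. c *s v) ` U = U"
proof
  show "(\<lambda>v. c *s v) ` U \<subseteq> U" using assms(1) by (auto intro: vec.subspace_scale)
  show "U \<subseteq> (\<lambda>v. c *s v) ` U"
  proof
    fix u assume "u \<in> U"
    then have "inverse c *s u \<in> U" using assms(1) by (auto intro: vec.subspace_scale)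
    moreover have "u = c *s (inverse c *s u)" using assms(2) by (simp add: vector_smult_assoc)
    ultimately show "u \<in> (\<lambda>v. c *s v) ` U" by blast
  qed
qed

lemma pg_act_eq:
  fixes U :: "('a::field ^ 'n) set"
  assumes g: "g \<in> carrier PGammaL" and f: "f \<in> g" and U: "U \<in> pg_points"
  shows "pg_act g U = f ` U"
proof -
  from g obtain k where k: "k \<in> carrier GammaL" "g = scalars #>\<^bsub>GammaL\<^esub> k"
    by (auto simp: PGammaL_def FactGroup_def RCOSETS_def)
  have im: "h ` U = k ` U" if h: "h \<in> g" for h
  proof -
    from h k obtain s where s: "s \<in> scalars" "h = s \<otimes>\<^bsub>GammaL\<^esub> k"
      by (auto simp: r_coset_def)
    from s(1) obtain c where c: "s = (\<lambda>v. c *s v)" "c \<noteq> 0" by (auto simp: scalars_def)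
    have h_eq: "h = s \<circ> k"
      using s(2) GammaL_mult'[OF _ k(1), of s] scalar_in_GammaL[OF c(2)] c(1) by simp
    from k(1) obtain \<sigma> where \<sigma>: "\<sigma> \<in> field_auts" "\<And>c v. k (c *s v) = \<sigma> c *s k v"
      by (auto simp: GammaL_carrier semilinear_def)
    then obtain d where d: "c = \<sigma> d"
      unfolding field_auts_iff by (metis bij_pointE)
    have "d \<noteq> 0"
      using \<sigma>(1) c(2) d unfolding field_auts_iff by (metis add_cancel_right_right)
    have "h ` U = k ` ((\<lambda>v. d *s v) ` U)"
      by (simp add: h_eq c(1) image_comp o_def \<sigma>(2) d)
    also have "(\<lambda>v. d *s v) ` U = U"
      using U \<open>d \<noteq> 0\<close> by (intro subspace_scale_image) (auto simp: pg_points_def)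
    finally show ?thesis .
  qed
  have "(SOME f. f \<in> g) \<in> g" using someI[of "\<lambda>f. f \<in> g", OF f] .
  then show ?thesis using im f by (simp add: pg_act_def)
qed

end

theory Submission
  imports
    Defs
    "HOL-Number_Theory.Residues"
    "HOL-Algebra.Sylow"
    "HOL-Algebra.Group_Action"
    "HOL-Algebra.Multiplicative_Group"
    "HOL-Analysis.Determinants"
begin

text \<open>
  Write \<open>F\<close> for the ground field and \<open>L\<close> for its algebraic closure.  A Singer group has as many
  elements as there are points, hence at least \<open>|F|\<close>, which is more than the number of automorphisms
  of \<open>F\<close>.  So two different elements \<open>g\<close> and \<open>h\<close> have semilinear representatives with the same
  associated automorphism, and the quotient of these representatives is a linear bijection of
  \<open>F\<^sup>n\<close>.  If it has an eigenvector, then \<open>g\<close> and \<open>h\<close> agree at the point spanned by this eigenvector,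
  against sharp transitivity.  As \<open>n\<close> is odd, the characteristic polynomial has odd degree, and it
  suffices that every polynomial of odd degree over \<open>F\<close> has a root in \<open>F\<close>
  (\<open>odd_degree_has_root\<close>).

  This is a part of the Artin-Schreier theorem, and it is proved by Galois theory.  Let \<open>G\<close> be the
  group of the automorphisms of \<open>L\<close> over \<open>F\<close>, which is finite because \<open>L\<close> has finite dimension.

  \<^item> An algebraically closed field has no automorphism of odd prime order \<open>q\<close>.  If \<open>q\<close> is not the
    characteristic (\<open>no_odd_prime_order_tame\<close>), there are \<open>a\<close> and a primitive \<open>q\<close>-th root of unity
    \<open>\<zeta>\<close> with \<open>\<sigma> a = \<zeta> * a\<close>; extracting a further \<open>q\<close>-th root \<open>b\<close> of \<open>a\<close> produces \<open>c = \<sigma> b / b\<close>, whose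
    norm is \<open>1\<close> by telescoping and \<open>\<zeta>\<close> by direct computation.  If \<open>q\<close> is the characteristic
    (\<open>no_prime_order_wild\<close>), the same role is played by \<open>x\<^sup>q - x\<close> and the trace.

  \<^item> By Cauchy's theorem the order of \<open>G\<close> has no odd prime factor, so every orbit of \<open>G\<close> is a
    singleton or has even size.  Dividing a polynomial of odd degree by the product of
    the linear factors over an even orbit of roots keeps it \<open>G\<close>-invariant and of odd degree, so some
    root is fixed by \<open>G\<close> (\<open>odd_degree_invariant_poly_has_fixed_root\<close>).

  \<^item> The fixed field of \<open>G\<close> is \<open>F\<close> (\<open>ac_auts_fixed_field\<close>).  For this, \<open>F\<close> is shown to be perfect, so
    that an element outside \<open>F\<close> has a second conjugate, and an embedding that moves the one to the
    other is extended to \<open>L\<close> one simple extension at a time.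
\<close>


section \<open>Automorphisms of a field\<close>

lemma field_aut_bij: "\<sigma> \<in> field_auts \<Longrightarrow> bij \<sigma>"
  by (simp add: field_auts_iff)

lemma field_aut_add: "\<sigma> \<in> field_auts \<Longrightarrow> \<sigma> (x + y) = \<sigma> x + \<sigma> y"
  by (simp add: field_auts_iff)

lemma field_aut_mult: "\<sigma> \<in> field_auts \<Longrightarrow> \<sigma> (x * y) = \<sigma> x * \<sigma> y"
  by (simp add: field_auts_iff)

lemma field_aut_one: "\<sigma> \<in> field_auts \<Longrightarrow> \<sigma> 1 = 1"
  by (simp add: field_auts_iff)

lemma field_aut_zero: "\<sigma> \<in> field_auts \<Longrightarrow> \<sigma> 0 = 0"
  using field_aut_add[of \<sigma> 0 0] by (simp only: add_0_right add_cancel_right_right)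

lemma field_aut_eq_0_iff: "\<sigma> \<in> field_auts \<Longrightarrow> \<sigma> x = 0 \<longleftrightarrow> x = 0"
  using field_aut_zero field_aut_bij by (metis bij_is_inj injD)

lemma field_aut_minus: "\<sigma> \<in> field_auts \<Longrightarrow> \<sigma> (- x) = - \<sigma> x"
  using field_aut_add[of \<sigma> x "- x"] field_aut_zero[of \<sigma>]
  by (metis add.right_inverse minus_unique)

lemma field_aut_diff: "\<sigma> \<in> field_auts \<Longrightarrow> \<sigma> (x - y) = \<sigma> x - \<sigma> y"
  using field_aut_add[of \<sigma> x "- y"] field_aut_minus[of \<sigma> y] by simp

lemma field_aut_power: "\<sigma> \<in> field_auts \<Longrightarrow> \<sigma> (x ^ n) = \<sigma> x ^ n"
  by (induction n) (simp_all add: field_aut_one field_aut_mult)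

lemma field_aut_inverse: "\<sigma> \<in> field_auts \<Longrightarrow> \<sigma> (inverse x) = inverse (\<sigma> x)"
  using field_aut_mult[of \<sigma> x "inverse x"] field_aut_one[of \<sigma>] field_aut_zero[of \<sigma>]
  by (cases "x = 0") (auto intro: inverse_unique[symmetric])

lemma field_aut_divide: "\<sigma> \<in> field_auts \<Longrightarrow> \<sigma> (x / y) = \<sigma> x / \<sigma> y"
  by (simp add: divide_inverse field_aut_mult field_aut_inverse)

lemma field_aut_sum: "\<sigma> \<in> field_auts \<Longrightarrow> \<sigma> (sum f A) = (\<Sum>x\<in>A. \<sigma> (f x))"
  by (induction A rule: infinite_finite_induct) (simp_all add: field_aut_zero field_aut_add)

lemma field_aut_of_nat: "\<sigma> \<in> field_auts \<Longrightarrow> \<sigma> (of_nat n) = of_nat n"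
  by (induction n) (simp_all add: field_aut_zero field_aut_one field_aut_add)

lemmas field_aut_simps = field_aut_add field_aut_mult field_aut_one field_aut_zero
  field_aut_eq_0_iff field_aut_minus field_aut_diff field_aut_power field_aut_inverse
  field_aut_divide field_aut_sum field_aut_of_nat

lemma id_field_aut: "id \<in> field_auts"
  by (simp add: field_auts_iff)

lemma comp_field_aut: "\<sigma> \<in> field_auts \<Longrightarrow> \<tau> \<in> field_auts \<Longrightarrow> \<sigma> \<circ> \<tau> \<in> field_auts"
  by (auto simp: field_auts_iff bij_comp)

lemma inv_field_aut:
  assumes "\<sigma> \<in> field_auts"
  shows "inv_into UNIV \<sigma> \<in> field_auts"
proof -
  have eqI: "x = y" if "\<sigma> x = \<sigma> y" for x y
    using that bij_is_inj[OF field_aut_bij[OF assms]] by (simp add: inj_eq)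
  have s: "\<sigma> (inv_into UNIV \<sigma> x) = x" for x
    using field_aut_bij[OF assms] by (simp add: bij_is_surj surj_f_inv_f)
  have "inv_into UNIV \<sigma> (x + y) = inv_into UNIV \<sigma> x + inv_into UNIV \<sigma> y"
    "inv_into UNIV \<sigma> (x * y) = inv_into UNIV \<sigma> x * inv_into UNIV \<sigma> y" "inv_into UNIV \<sigma> 1 = 1" for x y
    by (rule eqI, simp only: s field_aut_add[OF assms] field_aut_mult[OF assms] field_aut_one[OF assms])+
  then show ?thesis using bij_imp_bij_inv[OF field_aut_bij[OF assms]] by (simp add: field_auts_iff)
qed

lemma funpow_field_aut: "\<sigma> \<in> field_auts \<Longrightarrow> \<sigma> ^^ n \<in> field_auts"
  by (induction n) (auto simp: id_field_aut[unfolded id_def] id_field_aut intro: comp_field_aut)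

section \<open>Powers and linear independence of automorphisms\<close>

text \<open>
  Dedekind's lemma.  If two of the automorphisms differ at \<open>y\<close>, the relation at \<open>y * x\<close> minus a
  multiple of the relation at \<open>x\<close> is a relation with one term less.
\<close>

lemma dedekind_independence:
  fixes c :: "('b::field \<Rightarrow> 'b) \<Rightarrow> 'b"
  assumes "finite S" "S \<subseteq> field_auts" "\<And>x. (\<Sum>f\<in>S. c f * f x) = 0" "f \<in> S"
  shows "c f = 0"
  using assms
proof (induction S arbitrary: c f rule: finite_induct)
  case empty
  from empty.prems(3) show ?case by blast
next
  case (insert g S)
  have key: "c f = 0" if f: "f \<in> S" for f
  proof -
    have "f \<noteq> g" using f insert.hyps by blast
    then obtain y where y: "f y \<noteq> g y" by (metis ext)
    have "(\<Sum>f\<in>S. (c f * (f y - g y)) * f x) = 0" for x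
    proof -
      have "(\<Sum>f\<in>S. (c f * (f y - g y)) * f x)
          = (\<Sum>f\<in>insert g S. c f * f (y * x)) - g y * (\<Sum>f\<in>insert g S. c f * f x)"
        using insert.hyps insert.prems(1)
        by (auto simp: field_aut_mult subset_iff algebra_simps sum_distrib_left
            simp flip: sum_subtractf intro!: sum.cong)
      also have "\<dots> = 0" by (simp only: insert.prems(2) mult_zero_right diff_self)
      finally show ?thesis .
    qed
    then have "c f * (f y - g y) = 0"
      using insert.IH[of "\<lambda>f. c f * (f y - g y)" f] insert.prems(1) f by blast
    with y show ?thesis by simp
  qed
  have "c g = 0"
    using insert.prems(2)[of 1] key insert.hyps insert.prems(1)
    by (simp add: field_aut_one)
  with key insert.prems(3) show ?case by blast
qed

lemma coprime_funpow_eq_id: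
  assumes "\<sigma> ^^ k = id" "\<sigma> ^^ q = id" "coprime k q" "k \<noteq> 0"
  shows "\<sigma> = id"
proof -
  obtain a b where ab: "k * a = q * b + 1"
    using bezout_nat[OF assms(4), of q] assms(3) by auto
  have id: "id ^^ n = id" for n :: nat by (induction n) auto
  have "(\<sigma> ^^ k) ^^ a = \<sigma> ^^ (q * b + 1)" using ab by (simp add: funpow_mult mult.commute)
  also have "\<dots> = \<sigma> \<circ> (\<sigma> ^^ q) ^^ b" by (simp add: funpow_mult mult.commute)
  finally show ?thesis by (simp add: assms id)
qed

lemma inj_on_funpow_prime_order:
  assumes "bij \<sigma>" "prime q" "\<sigma> ^^ q = id" "\<sigma> \<noteq> id"
  shows "inj_on (\<lambda>i. \<sigma> ^^ i) {..<q}"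
proof (rule linorder_inj_onI)
  fix i j assume ij: "i < j" "i \<in> {..<q}" "j \<in> {..<q}"
  show "\<sigma> ^^ i \<noteq> \<sigma> ^^ j"
  proof
    assume eq: "\<sigma> ^^ i = \<sigma> ^^ j"
    have "\<sigma> ^^ j = \<sigma> ^^ i \<circ> \<sigma> ^^ (j - i)"
      using ij by (simp flip: funpow_add)
    then have "(\<sigma> ^^ i) ((\<sigma> ^^ (j - i)) x) = (\<sigma> ^^ i) x" for x
      using eq by (metis comp_apply)
    then have "\<sigma> ^^ (j - i) = id"
      using inj_fn[OF bij_is_inj[OF assms(1)], of i] by (auto simp: fun_eq_iff inj_eq)
    moreover have "coprime (j - i) q"
      using ij assms(2) by (metis coprime_commute lessThan_iff less_imp_diff_less nat_dvd_not_less
          prime_imp_coprime zero_less_diff)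
    ultimately have "\<sigma> = id" using assms(3) ij by (intro coprime_funpow_eq_id[of "j - i" \<sigma> q]) auto
    with assms show False by blast
  qed
qed auto

text \<open>
  Dedekind's lemma for the powers of one automorphism.  With \<open>c i = inverse (\<zeta> ^ i)\<close> the sum
  is a Lagrange resolvent, with \<open>c i = 1\<close> it is the trace.
\<close>

lemma sum_funpow_nonzero:
  fixes \<sigma> :: "'b::field \<Rightarrow> 'b"
  assumes "\<sigma> \<in> field_auts" "prime q" "\<sigma> ^^ q = id" "\<sigma> \<noteq> id" "\<And>i. i < q \<Longrightarrow> c i \<noteq> 0"
  obtains x where "(\<Sum>i<q. c i * (\<sigma> ^^ i) x) \<noteq> 0"
proof (rule ccontr)
  assume "\<not> thesis"
  then have z: "(\<Sum>i<q. c i * (\<sigma> ^^ i) x) = 0" for x using that by blast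
  note inj = inj_on_funpow_prime_order[OF field_aut_bij[OF assms(1)] assms(2-4)]
  define d where "d f = c (the_inv_into {..<q} (\<lambda>i. \<sigma> ^^ i) f)" for f
  have d: "d (\<sigma> ^^ i) = c i" if "i < q" for i
    using that by (simp add: d_def the_inv_into_f_f[OF inj])
  have q: "0 < q" using assms(2) prime_gt_0_nat by blast
  have "(\<Sum>f\<in>(\<lambda>i. \<sigma> ^^ i) ` {..<q}. d f * f x) = (\<Sum>i<q. c i * (\<sigma> ^^ i) x)" for x
    unfolding sum.reindex[OF inj] by (rule sum.cong) (auto simp: d)
  then have "d (\<sigma> ^^ 0) = 0"
    using z q by (intro dedekind_independence[where c = d and S = "(\<lambda>i. \<sigma> ^^ i) ` {..<q}"])
      (auto intro: funpow_field_aut assms(1) simp del: funpow.simps(1))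
  then show False using d[of 0] q assms(5)[of 0] by simp
qed

section \<open>Automorphisms of prime order of algebraically closed fields\<close>

lemma sum_lessThan_cyclic_shift:
  fixes h :: "nat \<Rightarrow> 'b::ab_group_add"
  assumes "h q = h 0"
  shows "(\<Sum>i<q. h (Suc i)) = (\<Sum>i<q. h i)"
  using sum.lessThan_Suc_shift[of h q] assms by simp

lemma degree_monom_diff: "degree r < n \<Longrightarrow> degree (monom (1 :: 'b::field) n - r) = n"
  using degree_add_eq_left[of "- r" "monom 1 n"] by (simp add: degree_monom_eq)

lemma alg_closed_root_exists:
  fixes p :: "'b::alg_closed_field poly"
  assumes "degree p > 0"
  obtains x where "poly p x = 0"
  using alg_closed_imp_poly_has_root[OF assms] by blast

lemma nth_root_exists:
  fixes a :: "'b::alg_closed_field"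
  assumes "n > 0"
  obtains b where "b ^ n = a"
proof -
  have "degree (monom 1 n - [:a:]) > 0"
    using assms by (subst degree_monom_diff) auto
  then show ?thesis
    using alg_closed_root_exists[of "monom 1 n - [:a:]"] that by (auto simp: poly_monom)
qed

lemma power_root_of_unity_inj:
  fixes \<eta> :: "'b::field"
  assumes "prime q" "\<eta> ^ q = 1" "\<eta> \<noteq> 1"
  shows "inj_on (\<lambda>i. \<eta> ^ i) {..<q}"
proof (rule linorder_inj_onI)
  have q: "q > 0" using assms(1) prime_gt_0_nat by blast
  have nz: "\<eta> \<noteq> 0" using assms(2) q by (auto simp: zero_power)
  fix i j assume ij: "i < j" "i \<in> {..<q}" "j \<in> {..<q}"
  show "\<eta> ^ i \<noteq> \<eta> ^ j"
  proof
    assume eq: "\<eta> ^ i = \<eta> ^ j"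
    have "\<eta> ^ j = \<eta> ^ i * \<eta> ^ (j - i)" using ij by (simp flip: power_add)
    then have 1: "\<eta> ^ (j - i) = 1" using eq nz by simp
    have "coprime (j - i) q"
      using ij assms(1) by (metis coprime_commute lessThan_iff less_imp_diff_less nat_dvd_not_less
          prime_imp_coprime zero_less_diff)
    then obtain a b where ab: "(j - i) * a = q * b + 1"
      using bezout_nat[of "j - i" q] ij by auto
    have "(\<eta> ^ (j - i)) ^ a = (\<eta> ^ q) ^ b * \<eta>"
      by (simp add: ab flip: power_mult power_Suc2)
    with assms 1 show False by simp
  qed
qed auto

text \<open>
  The powers of \<open>\<eta>\<close> are already \<open>q\<close> roots of \<open>X\<^sup>q - 1\<close>, and there cannot be more.
\<close>

lemma powers_exhaust_roots_of_unity:
  fixes \<eta> :: "'b::field"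
  assumes "prime q" "\<eta> ^ q = 1" "\<eta> \<noteq> 1" "x ^ q = 1"
  obtains k where "x = \<eta> ^ k"
proof -
  have q: "q > 0" using assms(1) prime_gt_0_nat by blast
  define p :: "'b poly" where "p = monom 1 q - 1"
  have deg: "degree p = q"
    unfolding p_def using q by (subst degree_monom_diff) auto
  have nz: "p \<noteq> 0" using deg q by auto
  have roots: "{x. poly p x = 0} = {x. x ^ q = 1}" by (auto simp: p_def poly_monom)
  let ?P = "(\<lambda>i. \<eta> ^ i) ` {..<q}"
  have "card ?P = q" using card_image[OF power_root_of_unity_inj[OF assms(1-3)]] by simp
  moreover have "?P \<subseteq> {x. x ^ q = 1}"
    using assms(2) by (auto simp flip: power_mult simp: mult.commute[of _ q]) (simp add: power_mult)
  moreover have "card {x :: 'b. x ^ q = 1} \<le> q"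
    using card_poly_roots_bound[OF nz] deg roots by simp
  moreover have "finite {x :: 'b. x ^ q = 1}" using poly_roots_finite[OF nz] roots by simp
  ultimately have "?P = {x. x ^ q = 1}" by (intro card_seteq) auto
  with assms(4) that show ?thesis by blast
qed

text \<open>
  If \<open>\<eta> \<noteq> 1\<close>, its powers are all the \<open>q\<close>-th roots of unity, so \<open>\<sigma> \<eta> = \<eta> ^ k\<close> for some \<open>k\<close>.  The \<open>q\<close>-th
  iterate of \<open>\<sigma>\<close> then maps \<open>\<eta>\<close> to \<open>\<eta> ^ (k ^ q)\<close>, which is \<open>\<eta> ^ k\<close> by Fermat; as this iterate is the
  identity, \<open>\<eta> ^ k = \<eta>\<close>.
\<close>

lemma field_aut_fixes_roots_of_unity:
  fixes \<sigma> :: "'b::field \<Rightarrow> 'b"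
  assumes \<sigma>: "\<sigma> \<in> field_auts" and q: "prime q" and "\<sigma> ^^ q = id" and \<eta>: "\<eta> ^ q = 1"
  shows "\<sigma> \<eta> = \<eta>"
proof (cases "\<eta> = 1")
  case True
  then show ?thesis using \<sigma> by (simp add: field_aut_one)
next
  case False
  have "\<sigma> \<eta> ^ q = 1" using \<eta> \<sigma> by (metis field_aut_one field_aut_power)
  then obtain k where k: "\<sigma> \<eta> = \<eta> ^ k"
    using powers_exhaust_roots_of_unity[OF q \<eta> False] by blast
  have "(\<sigma> ^^ n) \<eta> = \<eta> ^ (k ^ n)" for n
    by (induction n) (use \<sigma> k in \<open>simp_all add: field_aut_power flip: power_mult\<close>)
  then have pow: "\<eta> ^ (k ^ q) = \<eta>" using assms(3) by (metis id_apply)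
  have red: "\<eta> ^ n = \<eta> ^ (n mod q)" for n
  proof -
    have "\<eta> ^ n = \<eta> ^ (q * (n div q) + n mod q)" by simp
    also have "\<dots> = \<eta> ^ (n mod q)" by (simp only: power_add power_mult \<eta>) simp
    finally show ?thesis .
  qed
  have "[k ^ q = k] (mod q)"
  proof (cases "q dvd k")
    case True
    moreover have "q dvd k ^ q" using True q prime_gt_0_nat by (simp add: dvd_power_iff prime_dvd_power_iff)
    ultimately show ?thesis by (simp add: cong_def dvd_imp_mod_0)
  next
    case False
    then have "[k * k ^ (q - 1) = k * 1] (mod q)"
      using fermat_theorem[OF q] by (intro cong_mult) auto
    then show ?thesis using q prime_gt_0_nat by (metis Suc_pred' mult.right_neutral power_Suc)
  qed
  then have "\<eta> ^ (k ^ q) = \<eta> ^ k" using red[of "k ^ q"] red[of k] by (simp add: cong_def)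
  with pow k show ?thesis by simp
qed

lemma sum_lessThan_odd: "odd q \<Longrightarrow> q dvd (\<Sum>i<q. i)" for q :: nat
proof -
  have "(\<Sum>i<2 * r + 1. i) = r * (2 * r + 1)" for r :: nat by (induction r) auto
  then show "odd q \<Longrightarrow> q dvd (\<Sum>i<q. i)" by (metis dvd_triv_right oddE)
qed

text \<open>
  The contradiction is between two values of the norm \<open>\<Prod>i<q. (\<sigma> ^^ i) c\<close> of \<open>c = \<sigma> b / b\<close>, where
  \<open>b ^ q = a\<close> and \<open>\<sigma> a = \<zeta> * a\<close>.  It telescopes to \<open>1\<close>.  On the other hand \<open>\<sigma> c = c * \<eta>\<close> for a \<open>q\<close>-th
  root of unity \<open>\<eta>\<close>, so the norm is \<open>c ^ q * \<eta> ^ (q * (q - 1) div 2)\<close>; for odd \<open>q\<close> the second factor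
  is \<open>1\<close>, and \<open>c ^ q = \<zeta>\<close>.  (For \<open>q = 2\<close> this factor may be \<open>-1\<close>, as for complex conjugation.)
\<close>

lemma no_odd_prime_order_tame:
  fixes \<sigma> :: "'b::alg_closed_field \<Rightarrow> 'b"
  assumes \<sigma>: "\<sigma> \<in> field_auts" and q: "prime q" and "odd q" and ord: "\<sigma> ^^ q = id"
    and char: "of_nat q \<noteq> (0 :: 'b)"
  shows "\<sigma> = id"
proof (rule ccontr)
  assume neq: "\<sigma> \<noteq> id"
  have q1: "q > 1" using q prime_gt_1_nat by blast
  note fix_root = field_aut_fixes_roots_of_unity[OF \<sigma> q ord]
  \<comment> \<open>A root of \<open>1 + X + \<dots> + X ^ (q - 1)\<close>, which takes the value \<open>q\<close> at \<open>1\<close>.\<close>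
  obtain \<zeta> :: 'b where \<zeta>: "\<zeta> ^ q = 1" "\<zeta> \<noteq> 1"
  proof -
    let ?p = "\<Sum>i<q. monom (1 :: 'b) i"
    have "coeff ?p (q - 1) = 1" using q1 by (simp add: coeff_sum)
    then have "degree ?p \<ge> q - 1" by (intro le_degree) simp
    then obtain z where "poly ?p z = 0" using alg_closed_root_exists[of ?p] q1 by fastforce
    then have z: "(\<Sum>i<q. z ^ i) = 0" by (simp add: poly_sum poly_monom)
    then have "z \<noteq> 1" using char by auto
    moreover have "z ^ q = 1" using z by (metis eq_iff_diff_eq_0 mult_zero_right power_diff_1_eq)
    ultimately show ?thesis using that by blast
  qed
  have nz: "\<zeta> \<noteq> 0" using \<zeta>(1) q1 by (auto simp: zero_power)
  have f\<zeta>: "\<sigma> \<zeta> = \<zeta>" by (rule fix_root[OF \<zeta>(1)])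
  obtain x where x: "(\<Sum>i<q. inverse (\<zeta> ^ i) * (\<sigma> ^^ i) x) \<noteq> 0"
    using sum_funpow_nonzero[OF \<sigma> q ord neq, of "\<lambda>i. inverse (\<zeta> ^ i)"] nz by auto
  \<comment> \<open>The Lagrange resolvent is an eigenvector of \<open>\<sigma>\<close> with eigenvalue \<open>\<zeta>\<close>.\<close>
  define a where "a = (\<Sum>i<q. inverse (\<zeta> ^ i) * (\<sigma> ^^ i) x)"
  have "\<sigma> a = (\<Sum>i<q. \<zeta> * (inverse (\<zeta> ^ Suc i) * (\<sigma> ^^ Suc i) x))"
    unfolding a_def field_aut_sum[OF \<sigma>]
    by (rule sum.cong) (use nz \<sigma> in \<open>simp_all add: field_aut_simps f\<zeta> field_simps\<close>)
  also have "\<dots> = \<zeta> * a"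
    unfolding sum_distrib_left[symmetric] a_def
    by (subst sum_lessThan_cyclic_shift) (simp_all add: \<zeta> ord)
  finally have \<sigma>a: "\<sigma> a = \<zeta> * a" .
  obtain b where b: "b ^ q = a" using nth_root_exists q1 by (metis less_trans zero_less_one)
  have b0: "b \<noteq> 0" using b x q1 by (auto simp: a_def zero_power)
  define c where "c = \<sigma> b / b"
  have c0: "c \<noteq> 0" using b0 \<sigma> by (simp add: c_def field_aut_eq_0_iff)
  have cq: "c ^ q = \<zeta>"
    using \<sigma>a b x \<sigma> by (simp add: c_def power_divide a_def flip: field_aut_power)
  define \<eta> where "\<eta> = \<sigma> c / c"
  have \<eta>q: "\<eta> ^ q = 1" using cq f\<zeta> \<sigma> nz by (simp add: \<eta>_def power_divide flip: field_aut_power)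
  have f\<eta>: "\<sigma> \<eta> = \<eta>" by (rule fix_root[OF \<eta>q])
  have iter: "(\<sigma> ^^ i) c = c * \<eta> ^ i" for i
  proof (induction i)
    case (Suc i)
    have "\<sigma> c = c * \<eta>" using c0 by (simp add: \<eta>_def)
    with Suc show ?case using \<sigma> by (simp add: field_aut_simps f\<eta>)
  qed auto
  have tel: "(\<Prod>i<n. (\<sigma> ^^ i) c) = (\<sigma> ^^ n) b / b" for n
  proof (induction n)
    case (Suc n)
    have "(\<sigma> ^^ n) c = (\<sigma> ^^ Suc n) b / (\<sigma> ^^ n) b"
      using field_aut_divide[OF funpow_field_aut[OF \<sigma>]] by (simp add: c_def funpow_swap1)
    moreover have "(\<sigma> ^^ n) b \<noteq> 0"
      using b0 field_aut_eq_0_iff[OF funpow_field_aut[OF \<sigma>]] by blast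
    ultimately show ?case using Suc by simp
  qed (use b0 in auto)
  have "1 = (\<Prod>i<q. (\<sigma> ^^ i) c)" using tel[of q] ord b0 by simp
  also have "\<dots> = c ^ q * \<eta> ^ (\<Sum>i<q. i)"
    by (simp add: iter prod.distrib power_sum)
  also have "\<eta> ^ (\<Sum>i<q. i) = 1"
    using sum_lessThan_odd[OF \<open>odd q\<close>] \<eta>q by (auto simp: power_mult elim!: dvdE)
  finally show False using cq \<zeta> by simp
qed

text \<open>
  Additive analogue of the preceding argument.  There is \<open>y\<close> with \<open>\<sigma> y = y + 1\<close>, and then
  \<open>c = y ^ p - y\<close> is fixed by \<open>\<sigma>\<close>.  The trace \<open>T\<close> commutes with \<open>x \<mapsto> x ^ p - x\<close> and takes the value \<open>1\<close>
  at some \<open>t\<close>; so solving \<open>z ^ p - z = c * t\<close> in the algebraically closed field gives a fixed element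
  \<open>T z\<close> with \<open>(T z) ^ p - T z = c\<close>.  Then \<open>y - T z\<close> lies in the prime field, and so \<open>y\<close> is fixed too.
\<close>

lemma no_prime_order_wild:
  fixes \<sigma> :: "'b::alg_closed_field \<Rightarrow> 'b"
  assumes \<sigma>: "\<sigma> \<in> field_auts" and p: "prime p" and ord: "\<sigma> ^^ p = id"
    and char: "of_nat p = (0 :: 'b)"
  shows "\<sigma> = id"
proof (rule ccontr)
  assume neq: "\<sigma> \<noteq> id"
  have p1: "p > 1" using p prime_gt_1_nat by blast
  have CHAR: "CHAR('b) = p"
  proof -
    have "CHAR('b) dvd p" using char of_nat_eq_0_iff_char_dvd by blast
    moreover have "CHAR('b) \<noteq> 1" by simp
    ultimately show ?thesis using p prime_nat_iff by blast
  qed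
  have frob_add: "(x + y) ^ p = x ^ p + y ^ p" for x y :: 'b
    by (rule freshmans_dream) (simp_all add: CHAR p)
  have frob_sum: "(sum f A) ^ p = (\<Sum>i\<in>A. f i ^ p)" for f :: "nat \<Rightarrow> 'b" and A
    by (rule freshmans_dream_sum) (simp_all add: CHAR p)
  define T where "T x = (\<Sum>i<p. (\<sigma> ^^ i) x)" for x
  have T_fixed: "\<sigma> (T x) = T x" for x
  proof -
    have "\<sigma> (T x) = (\<Sum>i<p. (\<sigma> ^^ Suc i) x)" using \<sigma> by (simp add: T_def field_aut_sum)
    also have "\<dots> = T x" unfolding T_def by (rule sum_lessThan_cyclic_shift) (simp add: ord)
    finally show ?thesis .
  qed
  have fixed_pow: "(\<sigma> ^^ i) e = e" if "\<sigma> e = e" for e i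
    using that by (induction i) auto
  have T_scale: "T (e * x) = e * T x" if "\<sigma> e = e" for e x
    by (simp add: T_def field_aut_mult[OF funpow_field_aut[OF \<sigma>]] fixed_pow[OF that] sum_distrib_left)
  obtain x where x: "T x \<noteq> 0"
    using sum_funpow_nonzero[OF \<sigma> p ord neq, of "\<lambda>_. 1"] by (auto simp: T_def)
  define t where "t = x / T x"
  have Tt: "T t = 1"
    using T_scale[of "inverse (T x)" x] x \<sigma> T_fixed[of x]
    by (simp add: t_def divide_inverse field_aut_inverse mult.commute)
  \<comment> \<open>\<open>\<sigma>\<close> shifts the weights \<open>i\<close> by one, so it changes the weighted sum by \<open>T t = 1\<close>; that the
    last weight wraps around from \<open>p\<close> to \<open>0\<close> does not matter, since \<open>p = 0\<close> in the field.\<close>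
  define y where "y = - (\<Sum>i<p. of_nat i * (\<sigma> ^^ i) t)"
  have "\<sigma> (- y) = (\<Sum>i<p. of_nat i * (\<sigma> ^^ Suc i) t)"
    using \<sigma> by (simp add: y_def field_aut_simps)
  also have "\<dots> = (\<Sum>i<p. of_nat (Suc i) * (\<sigma> ^^ Suc i) t) - (\<Sum>i<p. (\<sigma> ^^ Suc i) t)"
    by (simp add: algebra_simps flip: sum_subtractf)
  also have "(\<Sum>i<p. of_nat (Suc i) * (\<sigma> ^^ Suc i) t) = (\<Sum>i<p. of_nat i * (\<sigma> ^^ i) t)"
    by (rule sum_lessThan_cyclic_shift) (simp add: char)
  also have "(\<Sum>i<p. (\<sigma> ^^ Suc i) t) = T t"
    unfolding T_def by (rule sum_lessThan_cyclic_shift) (simp add: ord)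
  finally have \<sigma>y: "\<sigma> y = y + 1" using \<sigma> Tt by (simp add: y_def field_aut_minus)
  define c where "c = y ^ p - y"
  have \<sigma>c: "\<sigma> c = c"
    using \<sigma> \<sigma>y by (simp add: c_def field_aut_simps frob_add)
  obtain z where z: "z ^ p - z = c * t"
  proof -
    let ?P = "monom 1 p - [:c * t, 1:]"
    have "degree ?P = p"
      using p1 by (subst degree_monom_diff) auto
    then obtain z where "poly ?P z = 0" using alg_closed_root_exists[of ?P] p1 by auto
    then show ?thesis using that[of z] by (simp add: poly_monom algebra_simps)
  qed
  have "T z ^ p - T z = T (z ^ p - z)"
    using funpow_field_aut[OF \<sigma>] by (simp add: T_def frob_sum field_aut_simps sum_subtractf)
  also have "\<dots> = c" using z T_scale[OF \<sigma>c] Tt by simp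
  finally have Tz: "T z ^ p - T z = c" .
  define w where "w = y - T z"
  have w: "w ^ p = w"
  proof -
    have "y ^ p = w ^ p + T z ^ p" using frob_add[of w "T z"] by (simp add: w_def)
    then show ?thesis using Tz by (simp add: c_def w_def algebra_simps)
  qed
  have \<sigma>w: "\<sigma> w = w + 1" using \<sigma> \<sigma>y T_fixed by (simp add: w_def field_aut_diff)
  \<comment> \<open>The \<open>p\<close> elements of the prime field are all the roots of \<open>X ^ p - X\<close>.\<close>
  have "w \<in> of_nat ` {..<p}"
  proof -
    let ?Q = "monom 1 p - [:0, 1 :: 'b:]"
    have deg: "degree ?Q = p"
      using p1 by (subst degree_monom_diff) auto
    have nz: "?Q \<noteq> 0" using deg p1 by auto
    have roots: "{x. poly ?Q x = 0} = {x. x ^ p = x}" by (auto simp: poly_monom)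
    have "inj_on (of_nat :: nat \<Rightarrow> 'b) {..<p}"
      using CHAR by (auto intro!: inj_onI simp: of_nat_eq_iff_cong_CHAR cong_def)
    then have card: "card ((of_nat :: nat \<Rightarrow> 'b) ` {..<p}) = p" by (simp add: card_image)
    have "(of_nat n :: 'b) ^ p = of_nat n" for n
      using p1 by (induction n) (simp_all add: frob_add)
    then have "(of_nat :: nat \<Rightarrow> 'b) ` {..<p} \<subseteq> {x. x ^ p = x}" by auto
    moreover have "card {x :: 'b. x ^ p = x} \<le> p"
      using card_poly_roots_bound[OF nz] deg roots by simp
    moreover have "finite {x :: 'b. x ^ p = x}" using poly_roots_finite[OF nz] roots by simp
    ultimately have "(of_nat :: nat \<Rightarrow> 'b) ` {..<p} = {x. x ^ p = x}"
      using card by (intro card_seteq) auto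
    with w show ?thesis by blast
  qed
  then have "\<sigma> w = w" using \<sigma> by (auto simp: field_aut_of_nat)
  with \<sigma>w show False by simp
qed

section \<open>Finite groups of automorphisms\<close>

text \<open>
  Maps under composition as a group record, so that Sylow's theorem and the orbit-stabiliser theorem
  apply to a set of field automorphisms.
\<close>

definition comp_group :: "('b \<Rightarrow> 'b) set \<Rightarrow> ('b \<Rightarrow> 'b) monoid" where
  "comp_group G = \<lparr>carrier = G, monoid.mult = (\<circ>), one = id\<rparr>"

lemma comp_group_simps [simp]:
  "carrier (comp_group G) = G" "x \<otimes>\<^bsub>comp_group G\<^esub> y = x \<circ> y" "\<one>\<^bsub>comp_group G\<^esub> = id"
  by (simp_all add: comp_group_def)

lemma comp_group_pow: "\<sigma> [^]\<^bsub>comp_group G\<^esub> n = \<sigma> ^^ n" for n :: nat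
  by (induction n) (simp_all add: funpow_Suc_right del: funpow.simps)

text \<open>
  An odd prime divisor would give, by Cauchy's theorem, an automorphism of odd prime order.
\<close>

lemma prime_divisor_order_aut_group:
  fixes G :: "('b::alg_closed_field \<Rightarrow> 'b) set"
  assumes grp: "group (comp_group G)" and fin: "finite G" and auts: "G \<subseteq> field_auts"
    and q: "prime q" "q dvd card G"
  shows "q = 2"
proof (rule ccontr)
  assume "q \<noteq> 2"
  then have odd: "odd q" using q(1) prime_odd_nat prime_ge_2_nat le_neq_implies_less by metis
  interpret group "comp_group G" by (rule grp)
  obtain m where "Coset.order (comp_group G) = q ^ 1 * m"
    using q(2) by (auto simp: Coset.order_def)
  then obtain H where H: "subgroup H (comp_group G)" "card H = q"
    using sylow_thm[OF q(1) grp, of 1 m] fin by auto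
  have "finite H" using H(1) fin subgroup.subset finite_subset by fastforce
  moreover have "id \<in> H" using subgroup.one_closed[OF H(1)] by simp
  moreover have "card H > 1" using H(2) q(1) prime_gt_1_nat by blast
  ultimately obtain \<sigma> where \<sigma>: "\<sigma> \<in> H" "\<sigma> \<noteq> id"
    by (metis card_le_Suc0_iff_eq not_less One_nat_def)
  interpret H: group "comp_group G\<lparr>carrier := H\<rparr>"
    using subgroup.subgroup_is_group[OF H(1) grp] .
  have "\<sigma> [^]\<^bsub>comp_group G\<lparr>carrier := H\<rparr>\<^esub> Coset.order (comp_group G\<lparr>carrier := H\<rparr>) = \<one>\<^bsub>comp_group G\<lparr>carrier := H\<rparr>\<^esub>"
    using \<sigma> \<open>finite H\<close> by (intro H.pow_order_eq_1) auto
  then have ord: "\<sigma> ^^ q = id"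
    using H(2) by (simp add: Coset.order_def comp_group_pow flip: nat_pow_consistent)
  have "\<sigma> \<in> field_auts" using \<sigma>(1) H(1) auts subgroup.subset by fastforce
  then have "\<sigma> = id"
    using no_odd_prime_order_tame no_prime_order_wild q(1) odd ord by blast
  with \<sigma> show False by simp
qed

lemma card_orbit_dvd:
  assumes grp: "group (comp_group G)" and bij: "\<And>\<sigma>. \<sigma> \<in> G \<Longrightarrow> bij \<sigma>"
  shows "card ((\<lambda>\<sigma>. \<sigma> x) ` G) dvd card G"
proof -
  have "group_action (comp_group G) UNIV id"
    unfolding group_action_def group_hom_def group_hom_axioms_def
    using grp bij by (auto intro!: homI group_BijGroup simp: GammaL_mult)
      (auto simp: BijGroup_def Bij_def)
  then have "card (orbit (comp_group G) id x) * card (stabilizer (comp_group G) id x) = Coset.order (comp_group G)"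
    by (rule group_action.orbit_stabilizer_theorem) simp
  moreover have "orbit (comp_group G) id x = (\<lambda>\<sigma>. \<sigma> x) ` G"
    by (auto simp: orbit_def)
  ultimately show ?thesis by (simp add: Coset.order_def) (metis dvd_triv_left)
qed

lemma map_poly_field_aut_mult:
  "\<sigma> \<in> field_auts \<Longrightarrow> map_poly \<sigma> (p * q) = map_poly \<sigma> p * map_poly \<sigma> q"
  by (rule poly_eqI) (simp add: coeff_map_poly coeff_mult field_aut_simps)

lemma map_poly_field_aut_prod:
  "\<sigma> \<in> field_auts \<Longrightarrow> map_poly \<sigma> (\<Prod>i\<in>A. f i) = (\<Prod>i\<in>A. map_poly \<sigma> (f i))"
  by (induction A rule: infinite_finite_induct)
    (simp_all add: map_poly_field_aut_mult field_aut_one)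

lemma prod_linear_factors_dvd:
  fixes p :: "'b::field poly"
  assumes "finite A" "\<And>x. x \<in> A \<Longrightarrow> poly p x = 0"
  shows "(\<Prod>x\<in>A. [:- x, 1:]) dvd p"
  using assms
proof (induction A rule: finite_induct)
  case (insert y A)
  then obtain q where q: "p = (\<Prod>x\<in>A. [:- x, 1:]) * q" by auto
  have "poly (\<Prod>x\<in>A. [:- x, 1:]) y \<noteq> 0"
    using insert.hyps by (auto simp: poly_prod)
  then have "poly q y = 0" using insert.prems[of y] q by simp
  then have "[:- y, 1:] dvd q" by (simp add: poly_eq_0_iff_dvd)
  then have "[:- y, 1:] * (\<Prod>x\<in>A. [:- x, 1:]) dvd q * (\<Prod>x\<in>A. [:- x, 1:])"
    by (rule mult_dvd_mono) simp
  then show ?case by (simp only: prod.insert[OF insert.hyps] q mult.commute[of _ q])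
qed auto

text \<open>
  An orbit of roots that is not a singleton has even size: its size divides the order of \<open>G\<close>, which
  has no odd prime factor.  The product of the linear factors over this orbit is invariant and
  divides \<open>p\<close>, so the quotient is again invariant of odd degree, and the induction continues with it.
\<close>

lemma odd_degree_invariant_poly_has_fixed_root:
  fixes G :: "('b::alg_closed_field \<Rightarrow> 'b) set"
  assumes grp: "group (comp_group G)" and fin: "finite G" and auts: "G \<subseteq> field_auts"
    and "odd (degree p)" "\<And>\<sigma>. \<sigma> \<in> G \<Longrightarrow> map_poly \<sigma> p = p"
  shows "\<exists>x. poly p x = 0 \<and> (\<forall>\<sigma>\<in>G. \<sigma> x = x)"
  using assms(4,5)
proof (induction "degree p" arbitrary: p rule: less_induct)
  case less
  interpret group "comp_group G" by (rule grp)
  have aut: "\<sigma> \<in> field_auts" if "\<sigma> \<in> G" for \<sigma> using that auts by blast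
  have comp: "\<sigma> \<circ> \<tau> \<in> G" if "\<sigma> \<in> G" "\<tau> \<in> G" for \<sigma> \<tau> using m_closed that by simp
  have one: "id \<in> G" using one_closed by simp
  from less.prems(1) have "degree p > 0" by (rule odd_pos)
  then obtain x where x: "poly p x = 0" by (rule alg_closed_root_exists)
  define A where "A = (\<lambda>\<sigma>. \<sigma> x) ` G"
  have finA: "finite A" using fin by (simp add: A_def)
  have xA: "x \<in> A" using image_eqI[of x "\<lambda>\<sigma>. \<sigma> x" id G] one by (simp add: A_def)
  show ?case
  proof (cases "A = {x}")
    case True
    then show ?thesis using x by (auto simp: A_def)
  next
    case False
    have "card A \<noteq> 1" using False xA by (metis card_1_singletonE singletonD)
    moreover have "card A dvd card G"
      unfolding A_def by (rule card_orbit_dvd[OF grp]) (simp add: aut field_aut_bij)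
    ultimately have even: "even (card A)"
      using prime_factor_nat[of "card A"] prime_divisor_order_aut_group[OF grp fin auts] dvd_trans by blast
    have root: "poly p (\<sigma> x) = 0" if "\<sigma> \<in> G" for \<sigma>
    proof -
      have "poly (map_poly \<sigma> p) (\<sigma> x) = \<sigma> (poly p x)"
        using aut[OF that] by (simp add: poly_altdef coeff_map_poly field_aut_simps degree_map_poly)
      then show ?thesis using less.prems(2)[OF that] x aut[OF that] by (simp add: field_aut_zero)
    qed
    define P where "P = (\<Prod>y\<in>A. [:- y, 1:])"
    have degP: "degree P = card A" by (simp add: P_def degree_prod_eq_sum_degree)
    have "P dvd p" unfolding P_def
      by (rule prod_linear_factors_dvd[OF finA]) (auto simp: A_def root)
    then obtain q where q: "p = P * q" by blast
    have nz: "p \<noteq> 0" using \<open>degree p > 0\<close> by auto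
    then have deg: "degree p = card A + degree q" using q degP by (auto simp: degree_mult_eq)
    have invP: "map_poly \<sigma> P = P" if "\<sigma> \<in> G" for \<sigma>
    proof -
      have inj: "inj_on \<sigma> A" using field_aut_bij[OF aut[OF that]] by (metis bij_is_inj inj_on_subset subset_UNIV)
      moreover have "\<sigma> ` A \<subseteq> A"
      proof (rule image_subsetI)
        fix z assume "z \<in> A"
        then obtain \<tau> where "\<tau> \<in> G" "z = \<tau> x" by (auto simp: A_def)
        then show "\<sigma> z \<in> A" using image_eqI[of "\<sigma> z" "\<lambda>\<sigma>. \<sigma> x" "\<sigma> \<circ> \<tau>" G] comp[OF that]
            by (simp add: A_def)
      qed
      ultimately have im: "\<sigma> ` A = A" by (simp add: endo_inj_surj finA)
      have "map_poly \<sigma> P = (\<Prod>y\<in>A. [:- \<sigma> y, 1:])"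
        using aut[OF that] by (simp add: P_def map_poly_field_aut_prod map_poly_pCons field_aut_simps)
      also have "\<dots> = (\<Prod>y\<in>\<sigma> ` A. [:- y, 1:])" by (simp add: prod.reindex[OF inj])
      finally show ?thesis by (simp add: im P_def)
    qed
    have "map_poly \<sigma> q = q" if "\<sigma> \<in> G" for \<sigma>
    proof -
      have "P * map_poly \<sigma> q = P * q"
        using less.prems(2)[OF that] invP[OF that] map_poly_field_aut_mult[OF aut[OF that], of P q] q
        by simp
      then show ?thesis using nz q by auto
    qed
    moreover have "degree q < degree p"
      using deg xA finA card_gt_0_iff by fastforce
    moreover have "odd (degree q)" using less.prems(1) deg even by simp
    ultimately obtain z where "poly q z = 0" "\<forall>\<sigma>\<in>G. \<sigma> z = z"
      using less.hyps by blast
    then show ?thesis using q by auto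
  qed
qed

section \<open>Embeddings of subfields\<close>

definition poly_over :: "'b::zero set \<Rightarrow> 'b poly set" where
  "poly_over R = {p. \<forall>i. coeff p i \<in> R}"

definition adjoin :: "'b::comm_semiring_0 set \<Rightarrow> 'b \<Rightarrow> 'b set" where
  "adjoin R x = (\<lambda>g. poly g x) ` poly_over R"

text \<open>
  A subfield \<open>R\<close> of a field, as a set, and an embedding \<open>\<phi>\<close> of \<open>R\<close> into another field.  The map \<open>\<phi>\<close>
  is total, but its values matter on \<open>R\<close> only; this makes it possible to speak about extensions of \<open>\<phi>\<close> to
  larger subfields.
\<close>

locale field_embedding =
  fixes R :: "'b::field set" and \<phi> :: "'b \<Rightarrow> 'c::field"
  assumes one_closed: "1 \<in> R"
    and diff_closed: "x \<in> R \<Longrightarrow> y \<in> R \<Longrightarrow> x - y \<in> R"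
    and mult_closed: "x \<in> R \<Longrightarrow> y \<in> R \<Longrightarrow> x * y \<in> R"
    and inverse_closed: "x \<in> R \<Longrightarrow> inverse x \<in> R"
    and hom_one: "\<phi> 1 = 1"
    and hom_diff: "x \<in> R \<Longrightarrow> y \<in> R \<Longrightarrow> \<phi> (x - y) = \<phi> x - \<phi> y"
    and hom_mult: "x \<in> R \<Longrightarrow> y \<in> R \<Longrightarrow> \<phi> (x * y) = \<phi> x * \<phi> y"
begin

lemma zero_closed: "0 \<in> R" using diff_closed[OF one_closed one_closed] by simp

lemma hom_zero: "\<phi> 0 = 0" using hom_diff[OF one_closed one_closed] by simp

lemma add_closed: "x \<in> R \<Longrightarrow> y \<in> R \<Longrightarrow> x + y \<in> R"
  using diff_closed[of x "0 - y"] diff_closed[OF zero_closed, of y] by simp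

lemma hom_add: "x \<in> R \<Longrightarrow> y \<in> R \<Longrightarrow> \<phi> (x + y) = \<phi> x + \<phi> y"
  using hom_diff[of x "0 - y"] hom_diff[OF zero_closed, of y] diff_closed[OF zero_closed, of y] hom_zero
  by simp

lemma sum_closed: "(\<And>i. i \<in> A \<Longrightarrow> f i \<in> R) \<Longrightarrow> sum f A \<in> R"
  by (induction A rule: infinite_finite_induct) (auto simp: zero_closed add_closed)

lemma hom_sum: "(\<And>i. i \<in> A \<Longrightarrow> f i \<in> R) \<Longrightarrow> \<phi> (sum f A) = (\<Sum>i\<in>A. \<phi> (f i))"
  by (induction A rule: infinite_finite_induct) (auto simp: hom_zero hom_add sum_closed)

lemma hom_nonzero: "\<phi> x \<noteq> 0" if "x \<in> R" "x \<noteq> 0"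
  using hom_mult[OF that(1) inverse_closed[OF that(1)]] that(2) hom_one by auto

lemma map_poly_diff:
  assumes "p \<in> poly_over R" "q \<in> poly_over R"
  shows "map_poly \<phi> (p - q) = map_poly \<phi> p - map_poly \<phi> q"
  using assms by (intro poly_eqI) (simp add: coeff_map_poly hom_zero hom_diff poly_over_def)

lemma map_poly_mult:
  assumes "p \<in> poly_over R" "q \<in> poly_over R"
  shows "map_poly \<phi> (p * q) = map_poly \<phi> p * map_poly \<phi> q"
  using assms
  by (intro poly_eqI)
    (simp add: coeff_map_poly hom_zero coeff_mult hom_sum hom_mult poly_over_def mult_closed)

lemma poly_over_diff: "p \<in> poly_over R \<Longrightarrow> q \<in> poly_over R \<Longrightarrow> p - q \<in> poly_over R"
  by (simp add: poly_over_def diff_closed)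

lemma poly_over_mult: "p \<in> poly_over R \<Longrightarrow> q \<in> poly_over R \<Longrightarrow> p * q \<in> poly_over R"
  by (simp add: poly_over_def coeff_mult sum_closed mult_closed)

lemma poly_over_const: "c \<in> R \<Longrightarrow> [:c:] \<in> poly_over R"
  by (auto simp: poly_over_def coeff_pCons zero_closed split: nat.splits)

lemma poly_over_monom: "c \<in> R \<Longrightarrow> monom c n \<in> poly_over R"
  by (auto simp: poly_over_def zero_closed)

lemma poly_over_add: "p \<in> poly_over R \<Longrightarrow> q \<in> poly_over R \<Longrightarrow> p + q \<in> poly_over R"
  by (simp add: poly_over_def add_closed)

lemma poly_over_X: "[:0, 1:] \<in> poly_over R"
  by (auto simp: poly_over_def coeff_pCons zero_closed one_closed split: nat.splits)

lemma adjoin_subset: "R \<subseteq> adjoin R x"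
  using poly_over_const unfolding adjoin_def by force

lemma adjoin_generator: "x \<in> adjoin R x"
  using poly_over_X unfolding adjoin_def by force

lemma adjoin_diff:
  assumes "u \<in> adjoin R x" "v \<in> adjoin R x"
  shows "u - v \<in> adjoin R x"
proof -
  obtain g h where gh: "g \<in> poly_over R" "h \<in> poly_over R" "u = poly g x" "v = poly h x"
    using assms unfolding adjoin_def by blast
  then have "u - v = poly (g - h) x" by simp
  with poly_over_diff[OF gh(1,2)] show ?thesis unfolding adjoin_def by blast
qed

lemma adjoin_add:
  assumes "u \<in> adjoin R x" "v \<in> adjoin R x"
  shows "u + v \<in> adjoin R x"
proof -
  obtain g h where gh: "g \<in> poly_over R" "h \<in> poly_over R" "u = poly g x" "v = poly h x"
    using assms unfolding adjoin_def by blast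
  then have "u + v = poly (g + h) x" by simp
  with poly_over_add[OF gh(1,2)] show ?thesis unfolding adjoin_def by blast
qed

lemma adjoin_mult:
  assumes "u \<in> adjoin R x" "v \<in> adjoin R x"
  shows "u * v \<in> adjoin R x"
proof -
  obtain g h where gh: "g \<in> poly_over R" "h \<in> poly_over R" "u = poly g x" "v = poly h x"
    using assms unfolding adjoin_def by blast
  then have "u * v = poly (g * h) x" by simp
  with poly_over_mult[OF gh(1,2)] show ?thesis unfolding adjoin_def by blast
qed

text \<open>
  The polynomials over \<open>R\<close> that vanish at \<open>\<alpha>\<close> are the multiples of the minimal polynomial \<open>f\<close>; so
  they also vanish, after applying \<open>\<phi>\<close>, at every root of the image of \<open>f\<close>.  The induction performs the
  division by \<open>f\<close> one leading term at a time.
\<close>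

lemma eval_eq_0_transfer:
  assumes f: "f \<in> poly_over R" "f \<noteq> 0" "poly f \<alpha> = 0"
    and min: "\<And>g. g \<in> poly_over R \<Longrightarrow> g \<noteq> 0 \<Longrightarrow> poly g \<alpha> = 0 \<Longrightarrow> degree f \<le> degree g"
    and \<beta>: "poly (map_poly \<phi> f) \<beta> = 0"
    and g: "g \<in> poly_over R" "poly g \<alpha> = 0"
  shows "poly (map_poly \<phi> g) \<beta> = 0"
  using g
proof (induction "degree g" arbitrary: g rule: less_induct)
  case less
  show ?case
  proof (cases "g = 0")
    case False
    let ?a = "lead_coeff f" and ?b = "lead_coeff g" and ?n = "degree g - degree f"
    have le: "degree f \<le> degree g" using min less.prems False by blast
    have R: "?a \<in> R" "?b \<in> R" using f(1) less.prems(1) by (auto simp: poly_over_def)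
    note overs = poly_over_mult[OF poly_over_const[OF R(1)] less.prems(1)]
      poly_over_mult[OF poly_over_monom[OF R(2)] f(1), of ?n]
    define h where "h = [:?a:] * g - monom ?b ?n * f"
    have h: "h \<in> poly_over R" unfolding h_def using overs by (rule poly_over_diff)
    have "degree (monom ?b ?n * f) \<le> degree g"
      using degree_mult_le[of "monom ?b ?n" f] degree_monom_le[of ?b ?n] le by linarith
    then have "degree h \<le> degree g" unfolding h_def by (intro degree_diff_le) auto
    moreover have "coeff h (degree g) = 0" using le by (simp add: h_def coeff_monom_mult)
    ultimately have "h = 0 \<or> degree h < degree g" by (intro eq_zero_or_degree_less)
    moreover have "poly h \<alpha> = 0" using less.prems f by (simp add: h_def)
    ultimately have "poly (map_poly \<phi> h) \<beta> = 0" using less.hyps h by auto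
    moreover have "map_poly \<phi> h = [:\<phi> ?a:] * map_poly \<phi> g - map_poly \<phi> (monom ?b ?n) * map_poly \<phi> f"
      unfolding h_def
      by (simp only: map_poly_diff[OF overs] map_poly_mult[OF poly_over_const[OF R(1)] less.prems(1)]
          map_poly_mult[OF poly_over_monom[OF R(2)] f(1)])
        (simp add: map_poly_pCons hom_zero)
    ultimately have "\<phi> ?a * poly (map_poly \<phi> g) \<beta> = 0" using \<beta> by simp
    moreover have "\<phi> ?a \<noteq> 0" using hom_nonzero R f(2) by simp
    ultimately show ?thesis by simp
  qed simp
qed

text \<open>
  By the preceding lemma, sending the value of \<open>g\<close> at \<open>\<alpha>\<close> to the value of the image of \<open>g\<close> at \<open>\<beta>\<close> does
  not depend on the choice of \<open>g\<close>.
\<close>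

lemma extend_to_simple_extension:
  assumes f: "f \<in> poly_over R" "f \<noteq> 0" "poly f \<alpha> = 0"
    and min: "\<And>g. g \<in> poly_over R \<Longrightarrow> g \<noteq> 0 \<Longrightarrow> poly g \<alpha> = 0 \<Longrightarrow> degree f \<le> degree g"
    and \<beta>: "poly (map_poly \<phi> f) \<beta> = 0"
    and inv: "\<And>x. x \<in> adjoin R \<alpha> \<Longrightarrow> inverse x \<in> adjoin R \<alpha>"
  obtains \<phi>' where "field_embedding (adjoin R \<alpha>) \<phi>'"
    "\<And>x. x \<in> R \<Longrightarrow> \<phi>' x = \<phi> x" "\<phi>' \<alpha> = \<beta>"
proof -
  define rep where "rep x = (SOME g. g \<in> poly_over R \<and> poly g \<alpha> = x)" for x
  define \<phi>' where "\<phi>' x = poly (map_poly \<phi> (rep x)) \<beta>" for x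
  have val: "\<phi>' (poly g \<alpha>) = poly (map_poly \<phi> g) \<beta>" if g: "g \<in> poly_over R" for g
  proof -
    have rep: "rep (poly g \<alpha>) \<in> poly_over R" "poly (rep (poly g \<alpha>)) \<alpha> = poly g \<alpha>"
      using someI[of "\<lambda>h. h \<in> poly_over R \<and> poly h \<alpha> = poly g \<alpha>" g] g by (auto simp: rep_def)
    have "poly (map_poly \<phi> (rep (poly g \<alpha>) - g)) \<beta> = 0"
      using rep g by (intro eval_eq_0_transfer[OF f min \<beta>] poly_over_diff) auto
    then show ?thesis using rep g by (simp add: \<phi>'_def map_poly_diff)
  qed
  have const: "\<phi>' x = \<phi> x" if "x \<in> R" for x
    using val[OF poly_over_const[OF that]] by (simp add: map_poly_pCons hom_zero)
  show ?thesis
  proof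
    show "field_embedding (adjoin R \<alpha>) \<phi>'"
    proof
      show "1 \<in> adjoin R \<alpha>"
        using adjoin_subset one_closed by blast
      show "\<phi>' 1 = 1" using const[OF one_closed] hom_one by simp
    next
      show "x - y \<in> adjoin R \<alpha>" "x * y \<in> adjoin R \<alpha>"
        if "x \<in> adjoin R \<alpha>" "y \<in> adjoin R \<alpha>" for x y
        using that by (rule adjoin_diff adjoin_mult)+
    next
      fix x y assume "x \<in> adjoin R \<alpha>" "y \<in> adjoin R \<alpha>"
      then obtain g h where gh: "g \<in> poly_over R" "h \<in> poly_over R" "x = poly g \<alpha>" "y = poly h \<alpha>"
        unfolding adjoin_def by blast
      show "\<phi>' (x - y) = \<phi>' x - \<phi>' y"
        using val[OF poly_over_diff[OF gh(1,2)]] val gh by (simp add: map_poly_diff)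
      show "\<phi>' (x * y) = \<phi>' x * \<phi>' y"
        using val[OF poly_over_mult[OF gh(1,2)]] val gh by (simp add: map_poly_mult)
    qed (rule inv)
    show "\<And>x. x \<in> R \<Longrightarrow> \<phi>' x = \<phi> x" by (rule const)
    show "\<phi>' \<alpha> = \<beta>" using val[OF poly_over_X] by (simp add: map_poly_pCons hom_zero hom_one)
  qed
qed

end

text \<open>
  Every \<open>x\<close> is algebraic over the base field.  In an equation for \<open>x\<close> with nonzero constant term, this
  term is a multiple of \<open>x\<close> by a polynomial expression in \<open>x\<close>.  If the constant term is zero, the
  equation can be divided by \<open>x\<close>.
\<close>

lemma inverse_in_subring:
  fixes x :: "'a::field alg_closure"
  assumes base: "range to_ac \<subseteq> R"
    and add: "\<And>x y. x \<in> R \<Longrightarrow> y \<in> R \<Longrightarrow> x + y \<in> R" and mult: "\<And>x y. x \<in> R \<Longrightarrow> y \<in> R \<Longrightarrow> x * y \<in> R"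
    and x: "x \<in> R"
  shows "inverse x \<in> R"
proof (cases "x = 0")
  case True
  then show ?thesis using x by simp
next
  case False
  have c: "to_ac c \<in> R" for c using base by blast
  have in_R: "poly (map_poly to_ac p) x \<in> R" for p
    by (induction p) (use c[of 0] in \<open>auto simp: map_poly_pCons c intro!: add mult x\<close>)
  obtain p :: "'a poly" where "p \<noteq> 0" "poly (map_poly to_ac p) x = 0"
    using alg_closure_algebraic by blast
  then show ?thesis
  proof (induction p)
    case (pCons a p)
    show ?case
    proof (cases "a = 0")
      case True
      then show ?thesis using pCons False by (auto simp: map_poly_pCons)
    next
      case a: False
      let ?y = "poly (map_poly to_ac p) x"
      have "to_ac a + x * ?y = 0" using pCons.prems by (simp add: map_poly_pCons)
      then have "x * (to_ac (- inverse a) * ?y) = 1"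
        using a by (simp add: field_simps add_eq_0_iff)
      then have "inverse x = to_ac (- inverse a) * ?y" by (rule inverse_unique)
      then show ?thesis using mult[OF c in_R] by metis
    qed
  qed simp
qed

text \<open>
  The Galois group of the algebraic closure over the base field.
\<close>

definition ac_auts :: "('a::field alg_closure \<Rightarrow> 'a alg_closure) set" where
  "ac_auts = {\<sigma> \<in> field_auts. \<forall>c. \<sigma> (to_ac c) = to_ac c}"

lemma field_embedding_base: "field_embedding (range to_ac) (\<lambda>x :: 'a::field alg_closure. x)"
proof
  show "1 \<in> range to_ac" by (metis rangeI to_ac_1)
qed (auto simp: image_iff simp flip: to_ac_diff to_ac_mult to_ac_inverse)

lemma min_poly_over_exists:
  fixes x :: "'a::field alg_closure"
  assumes "range to_ac \<subseteq> R"
  obtains f where "f \<in> poly_over R" "f \<noteq> 0" "poly f x = 0"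
    "\<And>g. g \<in> poly_over R \<Longrightarrow> g \<noteq> 0 \<Longrightarrow> poly g x = 0 \<Longrightarrow> degree f \<le> degree g"
proof -
  let ?P = "\<lambda>f. f \<in> poly_over R \<and> f \<noteq> 0 \<and> poly f x = 0"
  obtain p :: "'a poly" where p: "p \<noteq> 0" "poly (map_poly to_ac p) x = 0"
    using alg_closure_algebraic by blast
  have "map_poly to_ac p \<in> poly_over R"
    using assms by (auto simp: poly_over_def coeff_map_poly)
  moreover have "map_poly to_ac p \<noteq> 0" using p(1) by (subst map_poly_eq_0_iff) auto
  ultimately have "?P (map_poly to_ac p)" using p(2) by blast
  from ex_has_least_nat[of ?P, OF this, of degree] that show ?thesis by blast
qed

section \<open>The Galois group of a finite-dimensional algebraic closure\<close>

lemma subspace_subring: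
  assumes base: "range to_ac \<subseteq> R"
    and add: "\<And>x y. x \<in> R \<Longrightarrow> y \<in> R \<Longrightarrow> x + y \<in> R" and mult: "\<And>x y. x \<in> R \<Longrightarrow> y \<in> R \<Longrightarrow> x * y \<in> R"
  shows "ac.subspace R"
proof (rule ac.subspaceI)
  show "0 \<in> R" using base by (metis rangeI subsetD to_ac_0)
  show "ac_scale c x \<in> R" if "x \<in> R" for c x
    using mult[OF _ that, of "to_ac c"] base by (auto simp: ac_scale_def)
qed (rule add)

lemma CHAR_poly_field: "CHAR('b::field poly) = CHAR('b)"
  by (rule CHAR_eqI) (auto simp: of_nat_poly of_nat_eq_0_iff_char_dvd)

lemma coeff_pcompose_monom:
  assumes "k > 0"
  shows "coeff (pcompose q (monom 1 k)) (k * i) = coeff (q :: 'b::comm_ring_1 poly) i"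
proof (induction q arbitrary: i)
  case (pCons a q)
  show ?case
  proof (cases i)
    case 0
    then show ?thesis using assms by (simp add: pcompose_pCons coeff_monom_mult)
  next
    case (Suc j)
    have "coeff [:a:] (k * i) = 0" using assms Suc by (simp add: coeff_pCons split: nat.splits)
    then show ?thesis using assms Suc pCons(2)[of j]
      by (simp add: pcompose_pCons coeff_monom_mult)
  qed
qed simp

text \<open>
  A field that contains the \<open>p\<close>-th roots of its elements contains every element that is purely
  inseparable over it.  The second coefficient of
  \<open>(X - x) ^ d\<close> is \<open>- d * x\<close>, which settles the case that \<open>d\<close> is nonzero in the field.  Otherwise
  \<open>d = p * e\<close> with the characteristic \<open>p\<close>, and \<open>(X - x) ^ d = (X ^ p - x ^ p) ^ e\<close>, so
  \<open>(Y - x ^ p) ^ e\<close> has coefficients in \<open>F\<close>.  By induction \<open>x ^ p\<close> is in \<open>F\<close>, hence also \<open>x\<close>.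
\<close>

lemma perfect_subfield_contains_center:
  fixes F :: "'b::field set"
  assumes emb: "field_embedding F (\<lambda>x. x)"
    and perfect: "\<And>x. CHAR('b) > 0 \<Longrightarrow> x ^ CHAR('b) \<in> F \<Longrightarrow> x \<in> F"
    and "d > 0" "[:- x, 1:] ^ d \<in> poly_over F"
  shows "x \<in> F"
  using assms(3,4)
proof (induction d arbitrary: x rule: less_induct)
  case (less d)
  interpret field_embedding F "\<lambda>x. x" by (rule emb)
  have "d choose (d - 1) = d" using less.prems(1) by (cases d) simp_all
  then have "coeff ([:- x, 1:] ^ d) (d - 1) = - (of_nat d * x)"
    using less.prems(1) by (simp add: coeff_linear_poly_power)
  then have dx: "of_nat d * x \<in> F"
    using less.prems(2) diff_closed[OF zero_closed, of "- (of_nat d * x)"]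
    by (simp add: poly_over_def) (metis minus_minus)
  show ?case
  proof (cases "of_nat d = (0 :: 'b)")
    case False
    have "of_nat d \<in> F" by (induction d) (simp_all add: zero_closed add_closed one_closed)
    then have "inverse (of_nat d) * (of_nat d * x) \<in> F"
      by (rule mult_closed[OF inverse_closed dx])
    moreover have "inverse (of_nat d) * (of_nat d * x) = x" using False by simp
    ultimately show ?thesis by metis
  next
    case True
    define p where "p = CHAR('b)"
    have "p dvd d" using True by (simp add: p_def of_nat_eq_0_iff_char_dvd)
    then obtain e where e: "d = p * e" by blast
    have "p > 0" "e > 0" using e less.prems(1) by auto
    have pr: "prime p" using \<open>p > 0\<close> prime_CHAR_semidom unfolding p_def by blast
    have "([:0, 1:] + [:- x:]) ^ p = [:0, 1:] ^ p + [:- x:] ^ p"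
      by (rule freshmans_dream) (use pr in \<open>simp_all add: CHAR_poly_field p_def\<close>)
    also have "\<dots> = pcompose [:(- x) ^ p, 1:] (monom 1 p)"
      by (simp add: pcompose_pCons monom_altdef poly_const_pow)
    also have "(- x) ^ p = - (x ^ p)"
    proof -
      have "(x + (- x)) ^ p = x ^ p + (- x) ^ p"
        by (rule freshmans_dream) (use pr in \<open>simp_all add: p_def\<close>)
      then show ?thesis using \<open>p > 0\<close> by (simp add: zero_power eq_neg_iff_add_eq_0 add.commute)
    qed
    finally have frob: "[:- x, 1:] ^ p = pcompose [:- (x ^ p), 1:] (monom 1 p)" by simp
    have "[:- x, 1:] ^ d = pcompose ([:- (x ^ p), 1:] ^ e) (monom 1 p)"
      unfolding e power_mult frob by (induction e) (simp_all only: power_0 power_Suc pcompose_mult pcompose_1)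
    then have "coeff ([:- (x ^ p), 1:] ^ e) i = coeff ([:- x, 1:] ^ d) (p * i)" for i
      using coeff_pcompose_monom[OF \<open>p > 0\<close>] by metis
    then have "[:- (x ^ p), 1:] ^ e \<in> poly_over F" using less.prems(2) by (simp add: poly_over_def)
    moreover have "e < d" using e \<open>e > 0\<close> pr prime_gt_1_nat by simp
    ultimately have "x ^ p \<in> F" using less.IH \<open>e > 0\<close> by blast
    then show ?thesis using perfect \<open>p > 0\<close> by (simp add: p_def)
  qed
qed

locale finite_ac =
  fixes B :: "'a::field alg_closure set"
  assumes finite_B: "finite B" and indep_B: "ac.independent B" and span_B: "ac.span B = UNIV"
begin

sublocale fd: finite_dimensional_vector_space "ac_scale :: 'a \<Rightarrow> _" B
  by unfold_locales (rule finite_B indep_B span_B)+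

text \<open>
  The base field is perfect, by counting dimensions.  Raising to the power \<open>p\<close> maps the algebraic
  closure onto itself, so every element is a combination of the powers \<open>b ^ p\<close> of the basis elements
  with \<open>p\<close>-th powers as coefficients.  In particular these powers span, and being no more than the
  dimension they form a basis.  Comparing coordinates in two expressions of
  \<open>c * b0 ^ p\<close> shows that \<open>c\<close> is a \<open>p\<close>-th power.
\<close>

lemma frobenius_surj_base:
  assumes "CHAR('a) > 0"
  shows "\<exists>d. d ^ CHAR('a) = (c :: 'a)"
proof -
  define p where "p = CHAR('a)"
  have pr: "prime p" using assms prime_CHAR_semidom unfolding p_def by blast
  have p0: "p > 0" using assms by (simp add: p_def)
  have frob_sum: "(sum f A) ^ p = (\<Sum>i\<in>A. f i ^ p)" for f :: "'a alg_closure \<Rightarrow> 'a alg_closure" and A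
    by (rule freshmans_dream_sum) (use pr in \<open>simp_all add: p_def\<close>)
  have frob_diff: "(x - y) ^ p = x ^ p - y ^ p" for x y :: "'a alg_closure"
  proof -
    have "((x - y) + y) ^ p = (x - y) ^ p + y ^ p"
      by (rule freshmans_dream) (use pr in \<open>simp_all add: p_def\<close>)
    then show ?thesis by (simp add: algebra_simps)
  qed
  have inj: "inj_on (\<lambda>b :: 'a alg_closure. b ^ p) A" for A
  proof (rule inj_onI)
    fix x y :: "'a alg_closure" assume "x ^ p = y ^ p"
    then have "(x - y) ^ p = 0" by (simp add: frob_diff)
    then show "x = y" by simp
  qed
  have coords: "\<exists>u. y = (\<Sum>b\<in>B. ac_scale (u b) b)" for y
    using span_B ac.span_finite[OF finite_B] by auto
  have pow: "\<exists>u. x = (\<Sum>b\<in>B. ac_scale (u b ^ p) (b ^ p))" for x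
  proof -
    obtain y where y: "y ^ p = x" using nth_root_exists[OF p0] by blast
    obtain u where "y = (\<Sum>b\<in>B. ac_scale (u b) b)" using coords by blast
    then have "x = (\<Sum>b\<in>B. ac_scale (u b ^ p) (b ^ p))"
      using y by (simp add: frob_sum ac_scale_def power_mult_distrib)
    then show ?thesis by blast
  qed
  let ?B = "(\<lambda>b. b ^ p) ` B"
  have "x \<in> ac.span ?B" for x
  proof -
    obtain u where "x = (\<Sum>b\<in>B. ac_scale (u b ^ p) (b ^ p))" using pow by blast
    moreover have "\<dots> \<in> ac.span ?B"
      by (rule ac.span_sum, rule ac.span_scale, rule ac.span_base) simp
    ultimately show ?thesis by simp
  qed
  then have "UNIV \<subseteq> ac.span ?B" by blast
  moreover have "card ?B \<le> ac.dim (UNIV :: 'a alg_closure set)"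
    using card_image[OF inj] ac.dim_eq_card[of B UNIV] span_B indep_B by auto
  ultimately have ind: "ac.independent ?B"
    using fd.card_le_dim_spanning[of ?B UNIV] finite_B by auto
  have "B \<noteq> {}"
  proof
    assume "B = {}"
    then have "(1 :: 'a alg_closure) \<in> {0}" using span_B ac.span_empty by blast
    then show False by simp
  qed
  then obtain b0 where b0: "b0 \<in> B" by blast
  obtain u where u: "ac_scale c (b0 ^ p) = (\<Sum>b\<in>B. ac_scale (u b ^ p) (b ^ p))"
    using pow by blast
  define g where "g v = the_inv_into B (\<lambda>b. b ^ p) v" for v
  have g: "g (b ^ p) = b" if "b \<in> B" for b
    unfolding g_def using the_inv_into_f_f[OF inj that] .
  \<comment> \<open>The coordinates, in the basis of the powers \<open>b ^ p\<close>, of the difference of the two expressions.\<close>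
  define w where "w v = u (g v) ^ p - (if g v = b0 then c else 0)" for v
  have "(\<Sum>v\<in>?B. ac_scale (w v) v) = (\<Sum>b\<in>B. ac_scale (u b ^ p - (if b = b0 then c else 0)) (b ^ p))"
    unfolding sum.reindex[OF inj] by (rule sum.cong) (auto simp: w_def g)
  also have "\<dots> = (\<Sum>b\<in>B. ac_scale (u b ^ p) (b ^ p)) - (\<Sum>b\<in>B. if b = b0 then ac_scale c (b ^ p) else 0)"
    by (simp add: ac.scale_left_diff_distrib if_distrib[of "\<lambda>a. ac_scale a _"] flip: sum_subtractf cong: if_cong)
  also have "\<dots> = 0" using b0 finite_B u by simp
  finally have "w (b0 ^ p) = 0"
    using ac.independentD[OF ind, of ?B w "b0 ^ p"] b0 finite_B by blast
  then have "u b0 ^ p = c" using g[OF b0] by (simp add: w_def)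
  then show ?thesis unfolding p_def by blast
qed

text \<open>
  If \<open>x\<close> is the only root, then \<open>f\<close> is a constant times a power of \<open>X - x\<close>, and this puts \<open>x\<close> into
  the base field because the base field is perfect.
\<close>

lemma other_root_of_poly_over_base:
  assumes x: "x \<notin> range (to_ac :: 'a \<Rightarrow> _)"
    and f: "f \<in> poly_over (range to_ac)" "f \<noteq> 0" "poly f x = 0"
  obtains y where "y \<noteq> x" "poly f y = 0"
proof (rule ccontr)
  assume "\<not> thesis"
  then have only: "poly f y = 0 \<Longrightarrow> y = x" for y using that by blast
  interpret F: field_embedding "range (to_ac :: 'a \<Rightarrow> _)" "\<lambda>x. x" by (rule field_embedding_base)
  let ?d = "order x f"
  obtain q where q: "f = [:- x, 1:] ^ ?d * q" "\<not> [:- x, 1:] dvd q"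
    using order_decomp[OF f(2)] by blast
  have "degree q = 0"
  proof (rule ccontr)
    assume "degree q \<noteq> 0"
    then obtain y where y: "poly q y = 0" using alg_closed_root_exists[of q] by blast
    then have "poly f y = 0" using q(1) by (metis mult_zero_right poly_mult)
    then show False using only y q(2) by (metis poly_eq_0_iff_dvd)
  qed
  then obtain a where a: "q = [:a:]" by (rule degree_eq_zeroE)
  have fa: "f = smult a ([:- x, 1:] ^ ?d)" using q(1) a by simp
  have lc: "lead_coeff f = a"
    using arg_cong[OF fa, of lead_coeff] by (simp only: lead_coeff_smult lead_coeff_power) simp
  have "a \<noteq> 0" using lc f(2) by auto
  have "a \<in> range to_ac" using f(1) lc unfolding poly_over_def by blast
  then have ia: "inverse a \<in> range to_ac" by (rule F.inverse_closed)
  have "[:- x, 1:] ^ ?d = [:inverse a:] * f" using \<open>a \<noteq> 0\<close> by (subst fa) simp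
  also have "\<dots> \<in> poly_over (range to_ac)"
    by (rule F.poly_over_mult[OF F.poly_over_const[OF ia] f(1)])
  finally have "[:- x, 1:] ^ ?d \<in> poly_over (range to_ac)" .
  moreover have "?d > 0" using f(2,3) order_root by blast
  moreover have "y \<in> range to_ac"
    if "CHAR('a alg_closure) > 0" "y ^ CHAR('a alg_closure) \<in> range to_ac" for y :: "'a alg_closure"
  proof -
    let ?p = "CHAR('a)"
    from that obtain c where c: "y ^ ?p = to_ac c" by auto
    have "?p > 0" using that(1) by simp
    then obtain d where "d ^ ?p = c" using frobenius_surj_base[of c] by blast
    then have "y ^ ?p = to_ac d ^ ?p" using c by auto
    moreover have "(y - to_ac d + to_ac d) ^ ?p = (y - to_ac d) ^ ?p + to_ac d ^ ?p"
      by (rule freshmans_dream) (use that prime_CHAR_semidom in auto)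
    ultimately have "(y - to_ac d) ^ ?p = 0" by simp
    then have "y = to_ac d" by simp
    then show ?thesis by blast
  qed
  ultimately have "x \<in> range to_ac"
    using perfect_subfield_contains_center[OF field_embedding_base] by blast
  with x show False by blast
qed

text \<open>
  The embedding is an injective linear map of a finite-dimensional space, hence surjective.
\<close>

lemma base_fixing_embedding_is_ac_aut:
  assumes "field_embedding UNIV \<phi>" "\<And>c. \<phi> (to_ac c) = to_ac (c :: 'a)"
  shows "\<phi> \<in> ac_auts"
proof -
  interpret field_embedding UNIV \<phi> by (rule assms)
  have "Vector_Spaces.linear ac_scale ac_scale \<phi>"
    by unfold_locales (simp_all add: hom_add hom_mult ac_scale_def assms(2))
  moreover have "inj \<phi>"
  proof (rule injI)
    fix x y assume "\<phi> x = \<phi> y"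
    then have "\<phi> (x - y) = 0" by (simp add: hom_diff)
    then show "x = y" using hom_nonzero[of "x - y"] by auto
  qed
  ultimately have "bij \<phi>" using fd.linear_inj_imp_surj by (simp add: bij_def)
  then show ?thesis
    using assms(2) by (simp add: ac_auts_def field_auts_iff hom_add hom_mult hom_one)
qed

text \<open>
  Adjoining one more element to the domain raises its dimension, so after finitely many
  extensions the domain is the whole algebraic closure.
\<close>

lemma extend_to_ac_aut:
  assumes "field_embedding R \<phi>" "range to_ac \<subseteq> R" "\<And>c. \<phi> (to_ac c) = to_ac (c :: 'a)"
  obtains \<sigma> where "\<sigma> \<in> ac_auts" "\<And>x. x \<in> R \<Longrightarrow> \<sigma> x = \<phi> x"
  using assms
proof (induction "ac.dim (UNIV :: 'a alg_closure set) - ac.dim R" arbitrary: R \<phi> thesis rule: less_induct)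
  case less
  interpret field_embedding R \<phi> by (rule less.prems)
  show ?case
  proof (cases "R = UNIV")
    case True
    then show ?thesis using less.prems(1)[of \<phi>] base_fixing_embedding_is_ac_aut less.prems(2,4) by blast
  next
    case False
    then obtain x where x: "x \<notin> R" by blast
    obtain f where f: "f \<in> poly_over R" "f \<noteq> 0" "poly f x = 0"
      "\<And>g. g \<in> poly_over R \<Longrightarrow> g \<noteq> 0 \<Longrightarrow> poly g x = 0 \<Longrightarrow> degree f \<le> degree g"
      using min_poly_over_exists[OF less.prems(3)] by blast
    have "degree f > 0"
      using f(2,3) by (metis degree_eq_zeroE gr0I pCons_0_0 poly_const_conv)
    moreover have "degree (map_poly \<phi> f) = degree f"
      using f(1,2) hom_nonzero by (intro map_poly_degree_eq) (simp add: poly_over_def)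
    ultimately obtain y where y: "poly (map_poly \<phi> f) y = 0"
      using alg_closed_root_exists[of "map_poly \<phi> f"] by auto
    let ?R = "adjoin R x"
    have base: "R \<subseteq> ?R"
      by (rule adjoin_subset)
    have F: "range to_ac \<subseteq> ?R" using base less.prems(3) by blast
    obtain \<phi>' where \<phi>': "field_embedding ?R \<phi>'" "\<And>z. z \<in> R \<Longrightarrow> \<phi>' z = \<phi> z"
      using extend_to_simple_extension[OF f y] inverse_in_subring[OF F adjoin_add adjoin_mult] by blast
    have "ac.subspace R" "ac.subspace ?R"
      by (rule subspace_subring[OF less.prems(3) add_closed mult_closed]
          subspace_subring[OF F adjoin_add adjoin_mult]; assumption)+
    then have "ac.dim R < ac.dim ?R"
      using base x adjoin_generator[of x] fd.subspace_dim_equal[of R ?R] by (metis not_less)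
    moreover have "ac.dim ?R \<le> ac.dim (UNIV :: 'a alg_closure set)"
      by (rule fd.dim_subset) simp
    ultimately have "ac.dim (UNIV :: 'a alg_closure set) - ac.dim ?R < ac.dim (UNIV :: 'a alg_closure set) - ac.dim R"
      by linarith
    moreover have "\<phi>' (to_ac c) = to_ac c" for c
      using \<phi>'(2)[OF subsetD[OF less.prems(3) rangeI], of c] less.prems(4) by simp
    ultimately obtain \<sigma> where "\<sigma> \<in> ac_auts" "\<And>z. z \<in> ?R \<Longrightarrow> \<sigma> z = \<phi>' z"
      using less.hyps[of ?R \<phi>'] \<phi>'(1) F by blast
    then show ?thesis using less.prems(1)[of \<sigma>] \<phi>'(2) base by (metis subsetD)
  qed
qed

text \<open>
  An element \<open>x\<close> outside the base field has a conjugate \<open>y \<noteq> x\<close>, and the embedding of the field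
  generated by \<open>x\<close> that maps \<open>x\<close> to \<open>y\<close> extends to an automorphism, which moves \<open>x\<close>.
\<close>

theorem ac_auts_fixed_field:
  assumes "\<And>\<sigma>. \<sigma> \<in> ac_auts \<Longrightarrow> \<sigma> x = x"
  shows "x \<in> range (to_ac :: 'a \<Rightarrow> _)"
proof (rule ccontr)
  assume x: "x \<notin> range (to_ac :: 'a \<Rightarrow> _)"
  interpret F: field_embedding "range (to_ac :: 'a \<Rightarrow> _)" "\<lambda>x. x" by (rule field_embedding_base)
  let ?R = "adjoin (range (to_ac :: 'a \<Rightarrow> _)) x"
  obtain f where f: "f \<in> poly_over (range (to_ac :: 'a \<Rightarrow> _))" "f \<noteq> 0" "poly f x = 0"
      "\<And>g. g \<in> poly_over (range (to_ac :: 'a \<Rightarrow> _)) \<Longrightarrow> g \<noteq> 0 \<Longrightarrow> poly g x = 0 \<Longrightarrow> degree f \<le> degree g"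
    using min_poly_over_exists[OF order_refl] by blast
  obtain y where y: "y \<noteq> x" "poly f y = 0" using other_root_of_poly_over_base[OF x f(1-3)] by blast
  have base: "range to_ac \<subseteq> ?R" by (rule F.adjoin_subset)
  have "poly (map_poly (\<lambda>x. x) f) y = 0" using y by (simp add: map_poly_idI)
  then obtain \<phi> where \<phi>: "field_embedding ?R \<phi>" "\<And>z. z \<in> range to_ac \<Longrightarrow> \<phi> z = z" "\<phi> x = y"
    using F.extend_to_simple_extension[OF f] inverse_in_subring[OF base F.adjoin_add F.adjoin_mult] by blast
  obtain \<sigma> where "\<sigma> \<in> ac_auts" "\<And>z. z \<in> ?R \<Longrightarrow> \<sigma> z = \<phi> z"
    using extend_to_ac_aut[OF \<phi>(1) base] \<phi>(2) by blast
  note \<sigma> = this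
  have "\<sigma> x = y" using \<sigma>(2)[OF F.adjoin_generator] \<phi>(3) by simp
  moreover have "\<sigma> x = x" using assms \<sigma>(1) by blast
  ultimately show False using y(1) by simp
qed

text \<open>
  An automorphism over the base field is determined by its values on the basis, and it maps each basis
  element to one of the finitely many roots of a polynomial that this element satisfies.
\<close>

lemma finite_ac_auts: "finite (ac_auts :: ('a alg_closure \<Rightarrow> _) set)"
proof -
  have "\<exists>q. q \<noteq> 0 \<and> poly (map_poly to_ac (q :: 'a poly)) b = 0" for b
    using alg_closure_algebraic by blast
  then obtain q :: "'a alg_closure \<Rightarrow> 'a poly"
    where q: "\<And>b. q b \<noteq> 0" "\<And>b. poly (map_poly to_ac (q b)) b = 0" by metis
  let ?roots = "\<lambda>b. {x. poly (map_poly to_ac (q b)) x = 0}"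
  have "finite (?roots b)" for b
    by (rule poly_roots_finite) (subst map_poly_eq_0_iff; simp add: q)
  then have "finite (PiE B ?roots)" using finite_B by (intro finite_PiE)
  moreover have "(\<lambda>\<sigma>. restrict \<sigma> B) ` ac_auts \<subseteq> PiE B ?roots"
  proof (clarsimp simp: ac_auts_def)
    fix \<sigma> :: "'a alg_closure \<Rightarrow> 'a alg_closure" and b
    assume \<sigma>: "\<sigma> \<in> field_auts" "\<forall>c. \<sigma> (to_ac c) = to_ac c"
    have "\<sigma> (poly (map_poly to_ac (q b)) b) = poly (map_poly to_ac (q b)) (\<sigma> b)"
      using \<sigma> by (simp add: poly_altdef coeff_map_poly field_aut_simps)
    then show "poly (map_poly to_ac (q b)) (\<sigma> b) = 0" using q(2) \<sigma>(1) by (simp add: field_aut_zero)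
  qed
  ultimately have "finite ((\<lambda>\<sigma>. restrict \<sigma> B) ` ac_auts)" by (rule finite_subset[rotated])
  moreover have "inj_on (\<lambda>\<sigma>. restrict \<sigma> B) (ac_auts :: ('a alg_closure \<Rightarrow> _) set)"
  proof (rule inj_onI)
    fix \<sigma> \<tau> :: "'a alg_closure \<Rightarrow> 'a alg_closure"
    assume \<sigma>: "\<sigma> \<in> ac_auts" and \<tau>: "\<tau> \<in> ac_auts" and eq: "restrict \<sigma> B = restrict \<tau> B"
    have "ac.subspace {x. \<sigma> x = \<tau> x}"
      using \<sigma> \<tau> by (intro ac.subspaceI) (auto simp: ac_auts_def field_aut_simps ac_scale_def)
    moreover have "B \<subseteq> {x. \<sigma> x = \<tau> x}" using eq by (auto simp: restrict_def fun_eq_iff) meson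
    ultimately have "ac.span B \<subseteq> {x. \<sigma> x = \<tau> x}" by (rule ac.span_minimal[rotated])
    then show "\<sigma> = \<tau>" using span_B by auto
  qed
  ultimately show ?thesis by (rule finite_imageD)
qed

end

lemma group_ac_auts: "group (comp_group (ac_auts :: ('a::field alg_closure \<Rightarrow> _) set))"
proof (rule groupI)
  fix \<sigma> :: "'a alg_closure \<Rightarrow> 'a alg_closure" assume "\<sigma> \<in> carrier (comp_group ac_auts)"
  then have \<sigma>: "\<sigma> \<in> field_auts" "\<And>c. \<sigma> (to_ac c) = to_ac c" by (auto simp: ac_auts_def)
  have inj: "inj \<sigma>" using field_aut_bij[OF \<sigma>(1)] by (rule bij_is_inj)
  have "inv_into UNIV \<sigma> (to_ac c) = to_ac c" for c using inv_f_f[OF inj, of "to_ac c"] \<sigma>(2) by simp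
  then have "inv_into UNIV \<sigma> \<in> ac_auts" using inv_field_aut[OF \<sigma>(1)] by (simp add: ac_auts_def)
  moreover have "inv_into UNIV \<sigma> \<circ> \<sigma> = id" using inj by simp
  ultimately show "\<exists>\<tau>\<in>carrier (comp_group ac_auts). \<tau> \<otimes>\<^bsub>comp_group ac_auts\<^esub> \<sigma> = \<one>\<^bsub>comp_group ac_auts\<^esub>"
    by auto
qed (auto simp: ac_auts_def id_field_aut comp_field_aut o_assoc)

context finite_ac
begin

text \<open>
  Some root in the algebraic closure is fixed by the Galois group, whose fixed field is the base field.
\<close>

lemma odd_degree_has_root:
  fixes p :: "'a poly"
  assumes "odd (degree p)"
  shows "\<exists>c. poly p c = 0"
proof -
  let ?p = "map_poly to_ac p"
  have "degree ?p = degree p" by (rule degree_map_poly) simp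
  moreover have "map_poly \<sigma> ?p = ?p" if "\<sigma> \<in> ac_auts" for \<sigma> :: "'a alg_closure \<Rightarrow> _"
    using that by (intro poly_eqI) (simp add: ac_auts_def coeff_map_poly field_aut_zero)
  ultimately obtain x where x: "poly ?p x = 0" "\<forall>\<sigma>\<in>ac_auts. \<sigma> x = x"
    using odd_degree_invariant_poly_has_fixed_root[OF group_ac_auts finite_ac_auts, of ?p] assms
    by (auto simp: ac_auts_def)
  obtain c where "x = to_ac c" using ac_auts_fixed_field[of x] x(2) by blast
  then have "to_ac (poly p c) = 0"
    using x(1) by (simp add: poly_altdef coeff_map_poly degree_map_poly to_ac_sum)
  then show ?thesis by auto
qed

end

section \<open>Eigenvectors in odd dimension\<close>

definition charpoly :: "'a::field ^ 'n ^ 'n \<Rightarrow> 'a poly" where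
  "charpoly A = det (\<chi> i j. if i = j then [:- (A $ i $ j), 1:] else [:- (A $ i $ j):])"

lemma poly_charpoly: "poly (charpoly A) x = det (mat x - A)"
  unfolding charpoly_def det_def poly_sum
  by (rule sum.cong) (auto simp: poly_prod mat_def sign_def intro!: prod.cong)

text \<open>
  In the Leibniz formula the identity contributes the product of all diagonal entries, which are
  linear.  Any other permutation meets an entry off the diagonal, which is constant.
\<close>

lemma degree_charpoly: "degree (charpoly (A :: 'a::field ^ 'n ^ 'n)) = CARD('n)"
proof -
  let ?M = "\<chi> i j. if i = j then [:- (A $ i $ j), 1:] else [:- (A $ i $ j):]"
  let ?P = "{p. p permutes (UNIV :: 'n set)}"
  let ?t = "\<lambda>p. of_int (sign p) * (\<Prod>i\<in>UNIV. ?M $ i $ p i)"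
  have small: "degree (?t p) < CARD('n)" if p: "p \<in> ?P - {id}" for p
  proof -
    obtain k where k: "p k \<noteq> k" using p by (auto simp: fun_eq_iff)
    have "degree (?t p) \<le> degree (\<Prod>i\<in>UNIV. ?M $ i $ p i)"
      by (simp add: sign_def)
    also have "\<dots> \<le> (\<Sum>i\<in>UNIV. degree (?M $ i $ p i))"
      using degree_prod_sum_le[of UNIV "\<lambda>i. ?M $ i $ p i"] by (simp add: o_def)
    also have "\<dots> \<le> (\<Sum>i\<in>UNIV. if i = k then 0 else 1)"
      using k by (intro sum_mono) auto
    also have "\<dots> < (\<Sum>i\<in>(UNIV :: 'n set). 1)"
      by (rule sum_strict_mono_ex1) auto
    finally show ?thesis by simp
  qed
  have "degree (\<Sum>p\<in>?P - {id}. ?t p) < CARD('n)"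
    by (rule degree_sum_less) (use small in auto)
  moreover have "degree (?t id) = CARD('n)"
    by (simp add: degree_prod_eq_sum_degree)
  moreover have "charpoly A = ?t id + (\<Sum>p\<in>?P - {id}. ?t p)"
    unfolding charpoly_def det_def
    by (rule sum.remove) (auto simp: permutes_id finite_permutations)
  ultimately show ?thesis by (simp add: degree_add_eq_left)
qed

lemma eigenvector_of_charpoly_root:
  fixes A :: "'a::field ^ 'n ^ 'n"
  assumes "poly (charpoly A) x = 0"
  obtains v where "v \<noteq> 0" "A *v v = x *s v"
proof -
  have "det (mat x - A) = 0" using assms by (simp add: poly_charpoly)
  then have "\<not> invertible (mat x - A)" by (simp add: invertible_det_nz)
  then obtain v where "v \<noteq> 0" "(mat x - A) *v v = 0"
    by (metis invertible_left_inverse matrix_left_invertible_ker)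
  moreover have "mat x *v v = x *s v"
    by (simp add: vec_eq_iff matrix_vector_mult_def mat_def if_distrib[of "\<lambda>c. c * _"] cong: if_cong)
  ultimately show ?thesis using that by (simp add: matrix_vector_mult_diff_rdistrib)
qed

lemma (in finite_ac) linear_map_has_eigenvector:
  fixes f :: "'a ^ 'n \<Rightarrow> 'a ^ 'n"
  assumes "odd CARD('n)" "\<And>v w. f (v + w) = f v + f w" "\<And>c v. f (c *s v) = c *s f v"
  obtains v c where "v \<noteq> 0" "f v = c *s v"
proof -
  have "Vector_Spaces.linear (*s) (*s) f" by unfold_locales (use assms in auto)
  then have f: "f v = matrix f *v v" for v by (simp add: matrix_works)
  obtain c where "poly (charpoly (matrix f)) c = 0"
    using odd_degree_has_root[of "charpoly (matrix f)"] assms(1) by (auto simp: degree_charpoly)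
  then obtain v where "v \<noteq> 0" "matrix f *v v = c *s v" by (rule eigenvector_of_charpoly_root)
  then show ?thesis using that[of v c] f by simp
qed

section \<open>Points of projective space and Singer groups\<close>

lemma line_is_point: "v \<noteq> 0 \<Longrightarrow> vec.span {v :: 'a::field ^ 'n} \<in> pg_points"
  by (simp add: pg_points_def vec.dim_eq_card_independent)

lemma span_scaled_singleton:
  fixes w :: "'a::field ^ 'n"
  assumes "c \<noteq> 0"
  shows "vec.span {c *s w} = vec.span {w}"
proof -
  have "w = inverse c *s (c *s w)" using assms by (simp add: vector_smult_assoc)
  then have "w \<in> vec.span {c *s w}" by (metis vec.span_base vec.span_scale singletonI)
  then show ?thesis by (simp add: vec.span_eq vec.span_base vec.span_scale)
qed

lemma semilinear_image_span:
  assumes "semilinear f"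
  shows "f ` vec.span {v} = vec.span {f v}"
proof -
  obtain \<sigma> where \<sigma>: "\<sigma> \<in> field_auts" "\<And>c w. f (c *s w) = \<sigma> c *s f w"
    using assms by (auto simp: semilinear_def)
  then have "surj \<sigma>" using field_aut_bij bij_is_surj by blast
  then show ?thesis
    by (auto simp: vec.span_singleton \<sigma>(2) image_iff) (metis surjD)
qed

text \<open>
  In two coordinates the vectors \<open>(1, c)\<close> span pairwise different lines.
\<close>

lemma field_lepoll_points:
  assumes "CARD('n::finite) \<ge> 2"
  shows "(UNIV :: 'a::field set) \<lesssim> (pg_points :: ('a ^ 'n) set set)"
proof -
  obtain i j :: 'n where ij: "i \<noteq> j"
    using assms card_le_Suc0_iff_eq[of "UNIV :: 'n set"] by fastforce
  define v :: "'a \<Rightarrow> 'a ^ 'n" where "v c = (\<chi> k. if k = i then 1 else if k = j then c else 0)" for c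
  have vi: "v c $ i = 1" and vj: "v c $ j = c" for c using ij by (simp_all add: v_def)
  have "inj (\<lambda>c. vec.span {v c})"
  proof (rule injI)
    fix c d assume "vec.span {v c} = vec.span {v d}"
    then have "v c \<in> vec.span {v d}" using vec.span_base by blast
    then obtain k where k: "v c = k *s v d" by (auto simp: vec.span_singleton)
    have "k = 1" using arg_cong[OF k, of "\<lambda>w. w $ i"] by (simp add: vi)
    then show "c = d" using arg_cong[OF k, of "\<lambda>w. w $ j"] by (simp add: vj)
  qed
  moreover have "v c \<noteq> 0" for c using vi[of c] by auto
  ultimately show ?thesis
    unfolding lepoll_def by (intro exI[of _ "\<lambda>c. vec.span {v c}"]) (auto simp: line_is_point)
qed

theorem theorem7p1:
  fixes m :: nat
  assumes "alg_closure_degree TYPE('a::field) m"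
    and "m \<noteq> 1"
    and "(field_auts :: ('a \<Rightarrow> 'a) set) \<prec> (UNIV :: 'a set)"
    and "odd CARD('n::finite)"
    and "CARD('n) \<notin> {0, 1, 2}"
  shows "\<nexists>S :: ('a ^ 'n \<Rightarrow> 'a ^ 'n) set set. singer_group S"
proof
  assume "\<exists>S :: ('a ^ 'n \<Rightarrow> 'a ^ 'n) set set. singer_group S"
  then obtain S :: "('a ^ 'n \<Rightarrow> 'a ^ 'n) set set" where S: "singer_group S" ..
  have sub: "subgroup S PGammaL" using S unfolding singer_group_def ..
  have sharp: "\<exists>!g. g \<in> S \<and> pg_act g x = y" if "x \<in> pg_points" "y \<in> pg_points" for x y
    using S that by (simp add: singer_group_def)
  obtain B :: "'a alg_closure set" where "finite B" "ac.independent B" "ac.span B = UNIV"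
    using assms(1) by (auto simp: alg_closure_degree_def)
  then interpret finite_ac B by unfold_locales
  have car: "g \<in> carrier PGammaL" if "g \<in> S" for g
    using subgroup.subset[OF sub] that by blast
  have "\<exists>f \<sigma>. f \<in> g \<and> bij f \<and> semilinear f \<and> \<sigma> \<in> field_auts \<and> (\<forall>c v. f (c *s v) = \<sigma> c *s f v)"
    if g: "g \<in> S" for g
  proof -
    obtain f where f: "f \<in> carrier GammaL" "g = scalars #>\<^bsub>GammaL\<^esub> f"
      using car[OF g] by (auto simp: PGammaL_def FactGroup_def RCOSETS_def)
    have "f \<in> g"
      unfolding f(2) using f(1) normal_imp_subgroup[OF normal_scalars]
      by (rule group.rcos_self[OF group_GammaL])
    then show ?thesis using f(1) by (auto simp: GammaL_carrier semilinear_def)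
  qed
  then obtain f \<sigma> where f: "\<And>g. g \<in> S \<Longrightarrow> f g \<in> g" "\<And>g. g \<in> S \<Longrightarrow> bij (f g)"
      "\<And>g. g \<in> S \<Longrightarrow> semilinear (f g)" and \<sigma>: "\<And>g. g \<in> S \<Longrightarrow> \<sigma> g \<in> field_auts"
      "\<And>g c v. g \<in> S \<Longrightarrow> f g (c *s v) = \<sigma> g c *s f g v"
    by metis
  have add: "f g (v + w) = f g v + f g w" if "g \<in> S" for g v w
    using f(3)[OF that] by (simp add: semilinear_def)
  \<comment> \<open>If two elements have the same associated automorphism, they agree at some point.\<close>
  have "inj_on \<sigma> S"
  proof (rule inj_onI)
    fix g h assume g: "g \<in> S" and h: "h \<in> S" and eq: "\<sigma> g = \<sigma> h"
    \<comment> \<open>The automorphisms associated with \<open>f g\<close> and \<open>f h\<close> cancel, so \<open>k\<close> is linear.\<close>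
    define k where "k = inv_into UNIV (f h) \<circ> f g"
    have fk: "f h (k v) = f g v" for v
      using f(2)[OF h] by (simp add: k_def bij_is_surj surj_f_inv_f)
    have eqI: "v = w" if "f h v = f h w" for v w
      using that bij_is_inj[OF f(2)[OF h]] by (simp add: inj_eq)
    have "k (v + w) = k v + k w" "k (c *s v) = c *s k v" for v w c
      by (rule eqI, simp only: fk add[OF g] add[OF h] \<sigma>(2)[OF g] \<sigma>(2)[OF h] eq)+
    then obtain v c where v: "v \<noteq> 0" "k v = c *s v"
      using linear_map_has_eigenvector[OF assms(4), of k] by blast
    have fg: "f g v = \<sigma> h c *s f h v"
      using fk[of v] v(2) \<sigma>(2)[OF h] by simp
    moreover have gv: "f g v \<noteq> 0" and hv: "f h v \<noteq> 0"
      using v(1) add[OF g, of 0 0] add[OF h, of 0 0] bij_is_inj[OF f(2)[OF g]] bij_is_inj[OF f(2)[OF h]]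
      by (auto dest: injD[of _ v 0])
    ultimately have "vec.span {f g v} = vec.span {f h v}"
      by (metis span_scaled_singleton vector_smult_lzero)
    moreover have act: "pg_act u (vec.span {v}) = vec.span {f u v}" if "u \<in> S" for u
      using pg_act_eq[OF car[OF that] f(1)[OF that] line_is_point[OF v(1)]]
        semilinear_image_span[OF f(3)[OF that]] by simp
    ultimately have "pg_act g (vec.span {v}) = pg_act h (vec.span {v})" using g h by simp
    then show "g = h"
      using sharp[OF line_is_point[OF v(1)] line_is_point[OF hv]] act g h by metis
  qed
  then have S_le: "S \<lesssim> (field_auts :: ('a \<Rightarrow> 'a) set)"
    unfolding lepoll_def using \<sigma>(1) by blast
  have "CARD('n) \<noteq> 0" "CARD('n) \<noteq> 1" using assms(5) by auto
  then have "CARD('n) \<ge> 2" by linarith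
  have F_le: "(UNIV :: 'a set) \<lesssim> (pg_points :: ('a ^ 'n) set set)"
    by (rule field_lepoll_points[OF \<open>CARD('n) \<ge> 2\<close>])
  have p: "(vec.span {1} :: ('a ^ 'n) set) \<in> pg_points" by (rule line_is_point) (simp add: vec_eq_iff)
  \<comment> \<open>By transitivity the orbit of one point consists of all points.\<close>
  have "pg_points \<subseteq> (\<lambda>g. pg_act g (vec.span {1})) ` S"
  proof
    fix y :: "('a ^ 'n) set" assume "y \<in> pg_points"
    from ex1_implies_ex[OF sharp[OF p this]] show "y \<in> (\<lambda>g. pg_act g (vec.span {1})) ` S" by auto
  qed
  then have "(pg_points :: ('a ^ 'n) set set) \<lesssim> S" by (rule lepoll_trans[OF subset_imp_lepoll image_lepoll])
  then have "(UNIV :: 'a set) \<lesssim> (field_auts :: ('a \<Rightarrow> 'a) set)"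
    by (rule lepoll_trans[OF F_le lepoll_trans[OF _ S_le]])
  with assms(3) show False unfolding lesspoll_def using lepoll_antisym by blast
qed

end
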